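(* For every choice of parameters $d\in\mathbb{R}\setminus\{0\}$, $\zeta,\omega\in\mathbb{R}$ and every $f\in H^2(0,2\pi)$, the equation $$-d u''+\mathrm{i}\omega u'+(\zeta-\mathrm{i})u-|u|^2u+\mathrm{i}f(s)=0,\qquad u\ 2\pi\text{-periodic},$$ has at least one solution $u\in H^2_{\mathrm{per}}(0,2\pi)$.
   Context: All functions are complex valued. $H^2(0,2\pi)$ is the usual Sobolev space of square-integrable functions on $(0,2\pi)$ with square-integrable weak derivatives up to order $2$; $f\in H^2(0,2\pi)$ is regarded as extended $2\pi$-periodically to $\mathbb{R}$ (the extension need not be continuous). $H^2_{\mathrm{per}}(0,2\pi)$ is the space of locally square-integrable $2\pi$-periodic functions on $\mathbb{R}$ whose weak derivatives (on $\mathbb{R}$) up to order $2$ exist and are locally square-integrable. The equation is understood in $L^2(0,2\pi)$. *)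

theory Defs
  imports "HOL-Analysis.Analysis"
begin

text \<open>
  Elements of the function spaces below are represented by functions on the whole real line;
  values outside the set \<open>\<Omega>\<close> (and on null sets) are irrelevant, except that periodicity in \<open>sobolev_H_per\<close>
  is required pointwise (choice of a periodic representative).
\<close>

definition square_integrable_on :: "(real \<Rightarrow> complex) \<Rightarrow> real set \<Rightarrow> bool"
    (infix "square'_integrable'_on" 46) where
  "f square_integrable_on \<Omega> \<longleftrightarrow>
     f \<in> borel_measurable (lebesgue_on \<Omega>) \<and> integrable (lebesgue_on \<Omega>) (\<lambda>x. (cmod (f x))\<^sup>2)"

definition locally_integrable_on :: "(real \<Rightarrow> complex) \<Rightarrow> real set \<Rightarrow> bool"
    (infix "locally'_integrable'_on" 46) where
  "f locally_integrable_on \<Omega> \<longleftrightarrow>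
     (\<forall>K. compact K \<and> K \<subseteq> \<Omega> \<longrightarrow> integrable (lebesgue_on K) f)"

definition locally_square_integrable_on :: "(real \<Rightarrow> complex) \<Rightarrow> real set \<Rightarrow> bool"
    (infix "locally'_square'_integrable'_on" 46) where
  "f locally_square_integrable_on \<Omega> \<longleftrightarrow>
     (\<forall>K. compact K \<and> K \<subseteq> \<Omega> \<longrightarrow> f square_integrable_on K)"

text \<open>
  Real-valued test functions suffice: the identity defining a weak derivative is linear in the
  test function, so it extends to complex-valued ones by splitting into real and imaginary part.
\<close>

definition test_functions :: "real set \<Rightarrow> (real \<Rightarrow> real) set" where
  "test_functions \<Omega> =
     {\<phi>. (\<forall>n x. (deriv ^^ n) \<phi> field_differentiable at x) \<and>
         compact (closure {x. \<phi> x \<noteq> 0}) \<and> closure {x. \<phi> x \<noteq> 0} \<subseteq> \<Omega>}"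

text \<open>
  \<open>has_weak_deriv \<Omega> k f g\<close>: on the open set \<open>\<Omega>\<close>, \<open>g\<close> is the \<open>k\<close>-th weak derivative of \<open>f\<close>
  (unique up to null sets). Local integrability guarantees that both integrals exist.
\<close>

definition has_weak_deriv :: "real set \<Rightarrow> nat \<Rightarrow> (real \<Rightarrow> complex) \<Rightarrow> (real \<Rightarrow> complex) \<Rightarrow> bool" where
  "has_weak_deriv \<Omega> k f g \<longleftrightarrow>
     f locally_integrable_on \<Omega> \<and> g locally_integrable_on \<Omega> \<and>
     (\<forall>\<phi> \<in> test_functions \<Omega>.
        (LINT x|lebesgue_on \<Omega>. f x * of_real ((deriv ^^ k) \<phi> x)) =
        (-1) ^ k * (LINT x|lebesgue_on \<Omega>. g x * of_real (\<phi> x)))"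

definition sobolev_H :: "nat \<Rightarrow> real set \<Rightarrow> (real \<Rightarrow> complex) set" where
  "sobolev_H m \<Omega> =
     {f. f square_integrable_on \<Omega> \<and>
         (\<forall>k\<in>{1..m}. \<exists>g. has_weak_deriv \<Omega> k f g \<and> g square_integrable_on \<Omega>)}"

definition sobolev_H_per :: "nat \<Rightarrow> real \<Rightarrow> (real \<Rightarrow> complex) set" where
  "sobolev_H_per m T =
     {u. (\<forall>x. u (x + T) = u x) \<and> u locally_square_integrable_on UNIV \<and>
         (\<forall>k\<in>{1..m}. \<exists>v. has_weak_deriv UNIV k u v \<and> v locally_square_integrable_on UNIV)}"

end

theory Submission
  imports Defs "HOL-Complex_Analysis.Great_Picard"
begin

text \<open>
  The solution is the limit of solutions of the equation truncated to finitely many Fourier modes.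

  Restricted to trigonometric sums \<open>u = \<Sum>k\<in>K. c\<^sub>k e\<^sup>i\<^sup>k\<^sup>x\<close> and projected to the modes in \<open>K\<close>, the problem
  reads \<open>l\<^sub>k c\<^sub>k = N\<^sub>k(c) - \<i> f\<^sub>k\<close> with \<open>l\<^sub>k = d k\<^sup>2 - \<omega> k + \<zeta> - \<i>\<close>, where \<open>N\<^sub>k\<close> and \<open>f\<^sub>k\<close> are the Fourier
  coefficients of the cubic term and of \<open>f\<close>.  Pairing with \<open>c\<close> gives the real number
  \<open>(\<integral>|u|\<^sup>4) / 2\<pi>\<close> for the cubic term, so in the imaginary part only the damping and the forcing survive:
  \<open>\<i>\<close> times the vector field points outwards on a sphere whose radius depends on the \<open>L\<^sup>2\<close> norm of \<open>f\<close>
  alone.  Brouwer's theorem then yields a zero inside (\<open>galerkin_solution\<close>).  The dimension grows with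
  \<open>K\<close>, so the fixed point argument is carried out for functions on an arbitrary finite index set, from
  Kuhn's combinatorial lemma (\<open>poincare_miranda\<close>, \<open>exists_zero_in_ball\<close>).

  The real part of the same pairing controls the derivative whatever the signs of \<open>d\<close>, \<open>\<zeta>\<close>, \<open>\<omega>\<close>: the quartic
  term is at most \<open>(sup |u|)\<^sup>2\<close> times the squared \<open>L\<^sup>2\<close> norm, and \<open>(sup |u|)\<^sup>2\<close> is bounded by a small multiple of
  \<open>\<Sum>k\<^sup>2|c\<^sub>k|\<^sup>2\<close> plus a large multiple of \<open>\<Sum>|c\<^sub>k|\<^sup>2\<close> (\<open>galerkin_derivative_bound\<close>).  The bound makes the high
  modes uniformly small in the supremum norm, so a subsequence of the truncated solutions converges
  uniformly, and its continuous limit \<open>u\<close> satisfies the equation for every Fourier coefficient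
  (\<open>fourier_solution_exists\<close>).

  To recover the differential equation, move everything except \<open>-d u'' + \<i>\<omega>u'\<close> to the right-hand side \<open>h\<close>
  and integrate twice.  This produces a \<open>C\<^sup>1\<close> periodic function with the same Fourier coefficients as \<open>u\<close>,
  hence \<open>u\<close> itself (\<open>regularity_from_fourier_coeffs\<close>, \<open>continuous_periodic_fourier_coeff_eq_0\<close>).  Its derivative
  is the indefinite integral of a locally square-integrable function, and indefinite integrals have the
  expected weak derivatives by partial integration (\<open>has_weak_deriv_indefinite_integral\<close>).
\<close>

section \<open>Zeros of continuous maps that point outwards on a sphere\<close>

text \<open>
  The Poincare-Miranda theorem on the unit cube of dimension \<open>n\<close>, as a consequence of Kuhn's lemma: the
  sign of \<open>F\<close> labels the vertices of a grid of mesh \<open>1 / (p + 1)\<close>, and Kuhn's lemma finds a cell in which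
  every component of \<open>F\<close> takes both labels.  A limit of such cells as \<open>p\<close> grows is a common zero.
  Points are functions on \<open>nat\<close> and continuity is coordinatewise and sequential, so that the dimension is a
  number and not a type.
\<close>

lemma poincare_miranda:
  fixes F :: "(nat \<Rightarrow> real) \<Rightarrow> nat \<Rightarrow> real"
  assumes cont: "\<And>X x i. (\<And>j. j < n \<Longrightarrow> (\<lambda>p. X p j) \<longlonglongrightarrow> x j) \<Longrightarrow> i < n
                   \<Longrightarrow> (\<lambda>p. F (X p) i) \<longlonglongrightarrow> F x i"
    and low: "\<And>x i. (\<And>j. j < n \<Longrightarrow> 0 \<le> x j \<and> x j \<le> 1) \<Longrightarrow> i < n \<Longrightarrow> x i = 0 \<Longrightarrow> 0 \<le> F x i"
    and high: "\<And>x i. (\<And>j. j < n \<Longrightarrow> 0 \<le> x j \<and> x j \<le> 1) \<Longrightarrow> i < n \<Longrightarrow> x i = 1 \<Longrightarrow> F x i \<le> 0"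
  obtains x where "\<And>j. j < n \<Longrightarrow> 0 \<le> x j \<and> x j \<le> 1" "\<And>i. i < n \<Longrightarrow> F x i = 0"
proof -
  define sc where "sc p x = (\<lambda>j. real (x j) / real (Suc p))" for p and x :: "nat \<Rightarrow> nat"
  \<comment> \<open>On the two faces the label is prescribed by Kuhn's lemma, which agrees with the sign condition there.\<close>
  define lab where "lab p x i = (if x i = Suc p then 1 else if x i = 0 then 0
       else if 0 \<le> F (sc p x) i then 0 else (1::nat))" for p x i
  have cube: "0 \<le> sc p x j \<and> sc p x j \<le> 1" if "\<And>j. j < n \<Longrightarrow> x j \<le> Suc p" "j < n" for p x j
    using that(1)[OF that(2)] by (simp add: sc_def field_simps)
  have lab0: "0 \<le> F (sc p x) i" if "\<And>j. j < n \<Longrightarrow> x j \<le> Suc p" "i < n" "lab p x i = 0" for p x i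
  proof (cases "x i = 0")
    case True
    then show ?thesis using that cube by (intro low) (auto simp: sc_def)
  qed (use that in \<open>auto simp: lab_def split: if_splits\<close>)
  have lab1: "F (sc p x) i \<le> 0" if "\<And>j. j < n \<Longrightarrow> x j \<le> Suc p" "i < n" "lab p x i \<noteq> 0" for p x i
  proof (cases "x i = Suc p")
    case True
    then show ?thesis using that cube by (intro high) (auto simp: sc_def)
  qed (use that in \<open>auto simp: lab_def split: if_splits\<close>)
  have "\<forall>p. \<exists>q. (\<forall>i<n. q i < Suc p) \<and> (\<forall>i<n. \<exists>r s. (\<forall>j<n. q j \<le> r j \<and> r j \<le> q j + 1) \<and>
          (\<forall>j<n. q j \<le> s j \<and> s j \<le> q j + 1) \<and> lab p r i \<noteq> lab p s i)"
  proof
    fix p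
    have "0 < Suc p" "\<forall>x. (\<forall>i<n. x i \<le> Suc p) \<longrightarrow> (\<forall>i<n. lab p x i = (0::nat) \<or> lab p x i = 1)"
      "\<forall>x. (\<forall>i<n. x i \<le> Suc p) \<longrightarrow> (\<forall>i<n. x i = 0 \<longrightarrow> lab p x i = 0)"
      "\<forall>x. (\<forall>i<n. x i \<le> Suc p) \<longrightarrow> (\<forall>i<n. x i = Suc p \<longrightarrow> lab p x i = 1)"
      by (auto simp: lab_def)
    note labels = this
    obtain q where "\<forall>i<n. q i < Suc p"
      "\<forall>i<n. \<exists>r s. (\<forall>j<n. q j \<le> r j \<and> r j \<le> q j + 1) \<and>
          (\<forall>j<n. q j \<le> s j \<and> s j \<le> q j + 1) \<and> lab p r i \<noteq> lab p s i"
      by (rule kuhn_lemma[where n = n and p = "Suc p" and label = "lab p", OF labels])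
    then show "\<exists>q. (\<forall>i<n. q i < Suc p) \<and> (\<forall>i<n. \<exists>r s. (\<forall>j<n. q j \<le> r j \<and> r j \<le> q j + 1) \<and>
          (\<forall>j<n. q j \<le> s j \<and> s j \<le> q j + 1) \<and> lab p r i \<noteq> lab p s i)"
      by (intro exI[of _ q] conjI)
  qed
  from choice[OF this] obtain q where
    q: "\<forall>p. (\<forall>i<n. q p i < Suc p) \<and> (\<forall>i<n. \<exists>r s. (\<forall>j<n. q p j \<le> r j \<and> r j \<le> q p j + 1) \<and>
          (\<forall>j<n. q p j \<le> s j \<and> s j \<le> q p j + 1) \<and> lab p r i \<noteq> lab p s i)" ..
  have q1: "\<And>p i. i < n \<Longrightarrow> q p i < Suc p"
    and q2: "\<And>p i. i < n \<Longrightarrow> \<exists>r s. (\<forall>j<n. q p j \<le> r j \<and> r j \<le> q p j + 1) \<and>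
          (\<forall>j<n. q p j \<le> s j \<and> s j \<le> q p j + 1) \<and> lab p r i \<noteq> lab p s i"
    using q by simp_all
  have "norm (sc p (q p) j) \<le> 1" if "j \<in> {..<n}" for p j
    using cube[of "q p" p j] q1[of _ p] that by (simp add: order_less_imp_le)
  then obtain k where k: "strict_mono k"
     and "\<And>j. j \<in> {..<n} \<Longrightarrow> \<exists>l. (\<lambda>p. sc (k p) (q (k p)) j) \<longlonglongrightarrow> l"
    by (rule function_convergent_subsequence[of "{..<n}" "\<lambda>p. sc p (q p)", rotated]) auto
  then obtain x where x: "\<And>j. j < n \<Longrightarrow> (\<lambda>p. sc (k p) (q (k p)) j) \<longlonglongrightarrow> x j"
    by (metis lessThan_iff)
  show thesis
  proof
    fix j assume j: "j < n"
    have "0 \<le> sc (k p) (q (k p)) j \<and> sc (k p) (q (k p)) j \<le> 1" for p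
      using cube[of "q (k p)" "k p" j] q1[of _ "k p"] j by (simp add: order_less_imp_le)
    then show "0 \<le> x j \<and> x j \<le> 1"
      using x[OF j] by (meson LIMSEQ_le_const LIMSEQ_le_const2)
  next
    fix i assume i: "i < n"
    obtain r s where r: "\<And>p j. j < n \<Longrightarrow> q p j \<le> r p j \<and> r p j \<le> q p j + 1"
      and s: "\<And>p j. j < n \<Longrightarrow> q p j \<le> s p j \<and> s p j \<le> q p j + 1"
      and rs: "\<And>p. lab p (r p) i \<noteq> lab p (s p) i"
      using q2[OF i] by metis
    have lim: "(\<lambda>p. sc (k p) (t (k p)) j) \<longlonglongrightarrow> x j"
      if t: "\<And>p j. j < n \<Longrightarrow> q p j \<le> t p j \<and> t p j \<le> q p j + 1" and j: "j < n" for t j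
    proof -
      have "(\<lambda>p. sc p (t p) j - sc p (q p) j) \<longlonglongrightarrow> 0"
      proof (rule tendsto_sandwich[of "\<lambda>_. 0" _ _ "\<lambda>p. inverse (real (Suc p))"])
        show "\<forall>\<^sub>F p in sequentially. sc p (t p) j - sc p (q p) j \<le> inverse (real (Suc p))"
        proof (intro always_eventually allI)
          fix p
          have "real (t p j) - real (q p j) \<le> 1" using t[OF j, of p] by linarith
          then have "(real (t p j) - real (q p j)) / real (Suc p) \<le> 1 / real (Suc p)"
            by (intro divide_right_mono) auto
          then show "sc p (t p) j - sc p (q p) j \<le> inverse (real (Suc p))"
            by (simp add: sc_def diff_divide_distrib inverse_eq_divide)
        qed
        show "\<forall>\<^sub>F p in sequentially. 0 \<le> sc p (t p) j - sc p (q p) j"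
          using t[OF j] by (intro always_eventually allI) (simp add: sc_def divide_right_mono)
        show "(\<lambda>p. inverse (real (Suc p))) \<longlonglongrightarrow> 0" by (rule LIMSEQ_inverse_real_of_nat)
      qed simp
      then have "(\<lambda>p. sc (k p) (t (k p)) j - sc (k p) (q (k p)) j) \<longlonglongrightarrow> 0"
        using k by (rule LIMSEQ_subseq_LIMSEQ[unfolded o_def])
      from tendsto_add[OF this x[OF j]] show ?thesis by simp
    qed
    have "F (sc p (r p)) i * F (sc p (s p)) i \<le> 0" for p
    proof -
      have "r p j \<le> Suc p" "s p j \<le> Suc p" if "j < n" for j
        using r[OF that, of p] s[OF that, of p] q1[OF that, of p] by linarith+
      moreover have "lab p (r p) i = 0 \<and> lab p (s p) i \<noteq> 0 \<or> lab p (r p) i \<noteq> 0 \<and> lab p (s p) i = 0"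
        using rs[of p] by (auto simp: lab_def split: if_splits)
      ultimately show ?thesis
        using i lab0 lab1 by (metis mult_nonneg_nonpos mult_nonpos_nonneg)
    qed
    moreover have "(\<lambda>p. F (sc (k p) (r (k p))) i * F (sc (k p) (s (k p))) i) \<longlonglongrightarrow> F x i * F x i"
      using lim r s i by (intro tendsto_mult cont) auto
    ultimately have "F x i * F x i \<le> 0"
      by (meson LIMSEQ_le_const2)
    then show "F x i = 0"
      by (metis mult_eq_0_iff not_square_less_zero order_le_less)
  qed
qed

text \<open>
  Without a zero, \<open>x \<mapsto> - R G(x) / |G(x)|\<close> would map the ball to its boundary sphere.  Its fixed point has norm
  \<open>R\<close> and pairs negatively with \<open>G\<close>, against the assumption on the sphere.  The map is extended from the
  ball to the surrounding cube by the radial retraction, and the fixed point is found there.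
\<close>

lemma exists_zero_in_ball:
  fixes G :: "('i \<Rightarrow> real) \<Rightarrow> 'i \<Rightarrow> real"
  assumes fin: "finite I" and R: "R > 0"
    and cont: "\<And>X x i. (\<And>j. j \<in> I \<Longrightarrow> (\<lambda>p. X p j) \<longlonglongrightarrow> x j) \<Longrightarrow> i \<in> I
                   \<Longrightarrow> (\<lambda>p. G (X p) i) \<longlonglongrightarrow> G x i"
    and out: "\<And>x. (\<Sum>i\<in>I. (x i)\<^sup>2) = R\<^sup>2 \<Longrightarrow> 0 \<le> (\<Sum>i\<in>I. G x i * x i)"
  obtains x where "(\<Sum>i\<in>I. (x i)\<^sup>2) \<le> R\<^sup>2" "\<And>i. i \<in> I \<Longrightarrow> G x i = 0"
proof (rule ccontr)
  assume nz: "\<not> thesis"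
  define nrm where "nrm x = L2_set x I" for x :: "'i \<Rightarrow> real"
  have nrm2: "(nrm x)\<^sup>2 = (\<Sum>i\<in>I. (x i)\<^sup>2)" for x
    by (simp add: nrm_def L2_set_def sum_nonneg)
  have nrm_pos [simp]: "0 \<le> nrm x" for x by (simp add: nrm_def)
  have nrm_scale: "nrm (\<lambda>j. c * x j) = \<bar>c\<bar> * nrm x" for c x
    by (simp add: nrm_def L2_set_def power_mult_distrib real_sqrt_mult flip: sum_distrib_left)
  have lim_nrm: "(\<lambda>p. nrm (X p)) \<longlonglongrightarrow> nrm x" if "\<And>j. j \<in> I \<Longrightarrow> (\<lambda>p. X p j) \<longlonglongrightarrow> x j" for X x
    unfolding nrm_def L2_set_def by (intro tendsto_intros that)
  \<comment> \<open>The radial retraction onto the ball of radius \<open>R\<close>.\<close>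
  define r where "r x = (\<lambda>j. (R / max R (nrm x)) * x j)" for x
  have nr: "nrm (r x) \<le> R" for x
    unfolding r_def nrm_scale using R by (simp add: field_simps max_def)
  have Gnz: "nrm (G (r x)) \<noteq> 0" for x
  proof
    assume "nrm (G (r x)) = 0"
    then have "\<forall>i\<in>I. G (r x) i = 0" using fin by (simp add: nrm_def L2_set_eq_0_iff)
    then show False using nz that[of "r x"] nr[of x] nrm2[of "r x"]
      by (metis R less_imp_le nrm_pos power_mono)
  qed
  define \<Phi> where "\<Phi> x = (\<lambda>j. - R / nrm (G (r x)) * G (r x) j)" for x
  have n\<Phi>: "nrm (\<Phi> x) = R" for x
    unfolding \<Phi>_def nrm_scale using R Gnz[of x] by simp
  have \<Phi>_le: "\<bar>\<Phi> x i\<bar> \<le> R" if "i \<in> I" for x i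
    using member_le_L2_set[OF fin that, of "\<lambda>j. \<bar>\<Phi> x j\<bar>"] n\<Phi>[of x]
    by (simp add: nrm_def L2_set_def)
  have \<Phi>_lim: "(\<lambda>p. \<Phi> (X p) i) \<longlonglongrightarrow> \<Phi> x i"
    if X: "\<And>j. j \<in> I \<Longrightarrow> (\<lambda>p. X p j) \<longlonglongrightarrow> x j" and i: "i \<in> I" for X x i
  proof -
    have r: "(\<lambda>p. r (X p) j) \<longlonglongrightarrow> r x j" if "j \<in> I" for j
      unfolding r_def using R by (intro tendsto_intros lim_nrm X that) (auto simp: max_def)
    show ?thesis
      unfolding \<Phi>_def by (intro tendsto_intros lim_nrm cont r i Gnz)
  qed
  obtain b where b: "bij_betw b {..<card I} I"
    using fin bij_betw_from_nat_into_finite by blast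
  define a where "a = the_inv_into {..<card I} b"
  have ab: "a (b j) = j" if "j < card I" for j
    using b that by (simp add: a_def bij_betw_def the_inv_into_f_f)
  have ba: "b (a i) = i" "a i < card I" if "i \<in> I" for i
    using b that f_the_inv_into_f_bij_betw[of b] bij_betwE[OF bij_betw_the_inv_into[OF b]]
    by (auto simp: a_def)
  \<comment> \<open>The unit cube with coordinates \<open>{..<card I}\<close> is mapped affinely onto the cube \<open>[- R, R]\<close> over \<open>I\<close>.\<close>
  define dec where "dec y = (\<lambda>i. R * (2 * y (a i) - 1))" for y
  define F where "F y j = \<Phi> (dec y) (b j) - dec y (b j)" for y j
  have bI: "b j \<in> I" if "j < card I" for j using b that by (auto simp: bij_betw_def)
  obtain y where y: "\<And>j. j < card I \<Longrightarrow> F y j = 0"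
  proof (rule poincare_miranda[of "card I" F])
    fix X :: "nat \<Rightarrow> nat \<Rightarrow> real" and x i
    assume X: "\<And>j. j < card I \<Longrightarrow> (\<lambda>p. X p j) \<longlonglongrightarrow> x j" and i: "i < card I"
    have "(\<lambda>p. dec (X p) j) \<longlonglongrightarrow> dec x j" if "j \<in> I" for j
      unfolding dec_def by (intro tendsto_intros X ba that)
    then show "(\<lambda>p. F (X p) i) \<longlonglongrightarrow> F x i"
      unfolding F_def by (intro tendsto_intros \<Phi>_lim bI i) (auto intro: bI i)
  next
    fix x :: "nat \<Rightarrow> real" and i assume i: "i < card I"
    have *: "\<bar>\<Phi> (dec x) (b i)\<bar> \<le> R" using i bI \<Phi>_le by blast
    show "0 \<le> F x i" if "x i = 0" using * that i by (simp add: F_def dec_def ab)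
    show "F x i \<le> 0" if "x i = 1" using * that i by (simp add: F_def dec_def ab)
  qed auto
  define x where "x = dec y"
  have fp: "\<Phi> x i = x i" if "i \<in> I" for i
    using y[of "a i"] ba[OF that] by (simp add: F_def x_def)
  have "nrm x = R"
    using n\<Phi>[of x] fp by (simp add: nrm_def L2_set_def)
  then have rx: "r x = x" using R by (simp add: r_def)
  have "0 \<le> (\<Sum>i\<in>I. G x i * x i)"
    using out nrm2 \<open>nrm x = R\<close> by metis
  also have "\<dots> = (\<Sum>i\<in>I. G x i * \<Phi> x i)" using fp by simp
  also have "\<dots> = - R / nrm (G x) * (nrm (G x))\<^sup>2"
    unfolding nrm2 sum_distrib_left by (rule sum.cong) (auto simp: \<Phi>_def rx power2_eq_square)
  also have "\<dots> < 0"
    using R Gnz[of x] nrm_pos[of "G x"] by (simp add: rx power2_eq_square less_le)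
  finally show False by simp
qed

lemma exists_complex_zero_in_ball:
  fixes G :: "('i \<Rightarrow> complex) \<Rightarrow> 'i \<Rightarrow> complex"
  assumes fin: "finite K" and R: "R > 0"
    and cont: "\<And>X c i. (\<And>j. j \<in> K \<Longrightarrow> (\<lambda>p. X p j) \<longlonglongrightarrow> c j) \<Longrightarrow> i \<in> K
                   \<Longrightarrow> (\<lambda>p. G (X p) i) \<longlonglongrightarrow> G c i"
    and out: "\<And>c. (\<Sum>i\<in>K. (cmod (c i))\<^sup>2) = R\<^sup>2 \<Longrightarrow> 0 \<le> Re (\<Sum>i\<in>K. G c i * cnj (c i))"
  obtains c where "(\<Sum>i\<in>K. (cmod (c i))\<^sup>2) \<le> R\<^sup>2" "\<And>i. i \<in> K \<Longrightarrow> G c i = 0"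
proof -
  define dec where "dec x = (\<lambda>i. Complex (x (i, False)) (x (i, True)))" for x :: "'i \<times> bool \<Rightarrow> real"
  define H where "H x = (\<lambda>(i, b). if b then Im (G (dec x) i) else Re (G (dec x) i))" for x
  have split: "(\<Sum>i\<in>K \<times> UNIV. g i) = (\<Sum>i\<in>K. g (i, False) + g (i, True))" for g :: "'i \<times> bool \<Rightarrow> real"
  proof -
    have "(\<Sum>i\<in>K \<times> UNIV. g i) = (\<Sum>i\<in>K. \<Sum>b\<in>UNIV. g (i, b))"
      by (simp add: sum.cartesian_product)
    then show ?thesis by (simp add: UNIV_bool add.commute)
  qed
  have n: "(\<Sum>i\<in>K \<times> UNIV. (x i)\<^sup>2) = (\<Sum>i\<in>K. (cmod (dec x i))\<^sup>2)" for x
    by (simp add: split dec_def cmod_power2)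
  obtain x where x: "(\<Sum>i\<in>K \<times> UNIV. (x i)\<^sup>2) \<le> R\<^sup>2" and H0: "\<And>i. i \<in> K \<times> UNIV \<Longrightarrow> H x i = 0"
  proof (rule exists_zero_in_ball[of "K \<times> UNIV" R H])
    fix X :: "nat \<Rightarrow> 'i \<times> bool \<Rightarrow> real" and x :: "'i \<times> bool \<Rightarrow> real" and i
    assume X: "\<And>j. j \<in> K \<times> UNIV \<Longrightarrow> (\<lambda>p. X p j) \<longlonglongrightarrow> x j" and i: "i \<in> K \<times> (UNIV :: bool set)"
    obtain k b where ib: "i = (k, b)" and k: "k \<in> K" using i by auto
    have "(\<lambda>p. dec (X p) j) \<longlonglongrightarrow> dec x j" if "j \<in> K" for j
      unfolding dec_def using that by (intro tendsto_Complex X) auto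
    then have "(\<lambda>p. G (dec (X p)) k) \<longlonglongrightarrow> G (dec x) k"
      using cont[of "\<lambda>p. dec (X p)" "dec x" k] k by blast
    then show "(\<lambda>p. H (X p) i) \<longlonglongrightarrow> H x i"
      unfolding H_def ib by (auto intro: tendsto_intros)
  next
    fix x :: "'i \<times> bool \<Rightarrow> real"
    assume "(\<Sum>i\<in>K \<times> UNIV. (x i)\<^sup>2) = R\<^sup>2"
    then have "0 \<le> Re (\<Sum>i\<in>K. G (dec x) i * cnj (dec x i))" by (intro out) (simp add: n)
    then show "0 \<le> (\<Sum>i\<in>K \<times> UNIV. H x i * x i)"
      by (simp add: split H_def dec_def)
  qed (use fin R in auto)
  show thesis
  proof
    show "(\<Sum>i\<in>K. (cmod (dec x i))\<^sup>2) \<le> R\<^sup>2" using x by (simp add: n)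
    show "G (dec x) i = 0" if "i \<in> K" for i
      using H0[of "(i, False)"] H0[of "(i, True)"] that by (simp add: H_def complex_eq_iff)
  qed
qed

section \<open>Trigonometric sums and Fourier coefficients\<close>

definition trig_sum :: "int set \<Rightarrow> (int \<Rightarrow> complex) \<Rightarrow> real \<Rightarrow> complex" where
  "trig_sum K c x = (\<Sum>k\<in>K. c k * cis (of_int k * x))"

definition fourier_coeff :: "(real \<Rightarrow> complex) \<Rightarrow> int \<Rightarrow> complex" where
  "fourier_coeff g k = integral {0..2 * pi} (\<lambda>x. g x * cis (- (of_int k * x))) / (2 * pi)"

lemma has_vector_derivative_cis:
  "((\<lambda>x. cis (a * x)) has_vector_derivative \<i> * of_real a * cis (a * x)) (at x within S)"
proof -
  have "((\<lambda>z. exp (\<i> * of_real a * z)) has_field_derivative \<i> * of_real a * exp (\<i> * of_real a * of_real x))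
          (at (of_real x))"
    by (auto intro!: derivative_eq_intros)
  from has_vector_derivative_real_field[OF this, of S] show ?thesis
    by (simp add: cis_conv_exp mult.assoc)
qed

lemma cis_int_period [simp]: "cis (of_int k * (x + 2 * pi)) = cis (of_int k * x)"
proof -
  have "cis (of_int k * (x + 2 * pi)) = cis (of_int k * x) * cis (2 * pi * of_int k)"
    by (simp add: cis_mult algebra_simps)
  then show ?thesis by (simp add: cis_multiple_2pi)
qed

lemma continuous_trig_sum [continuous_intros]: "continuous_on S (trig_sum K c)"
  unfolding trig_sum_def[abs_def] by (intro continuous_intros)

lemma trig_sum_period: "trig_sum K c (x + 2 * pi) = trig_sum K c x"
  by (simp add: trig_sum_def)

lemma norm_trig_sum_le: "cmod (trig_sum K c x) \<le> (\<Sum>k\<in>K. cmod (c k))"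
  unfolding trig_sum_def by (rule order_trans[OF norm_sum]) (simp add: norm_mult)

lemma integral_cis_int:
  "integral {0..2 * pi} (\<lambda>x. cis (of_int m * x)) = (if m = 0 then 2 * pi else 0)"
proof (cases "m = 0")
  case False
  have "((\<lambda>x. cis (of_int m * x)) has_integral
      cis (of_int m * (2 * pi)) / (\<i> * of_int m) - cis (of_int m * 0) / (\<i> * of_int m)) {0..2 * pi}"
  proof (rule fundamental_theorem_of_calculus)
    fix x :: real
    show "((\<lambda>x. cis (of_int m * x) / (\<i> * of_int m)) has_vector_derivative cis (of_int m * x))
            (at x within {0..2 * pi})"
      using has_vector_derivative_divide[OF has_vector_derivative_cis[of "of_int m" x "{0..2*pi}"],
          of "\<i> * of_int m"] False by simp
  qed simp
  moreover have "cis (of_int m * (2 * pi)) = 1"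
    using cis_int_period[of m 0] by simp
  ultimately show ?thesis using False by (simp add: integral_unique)
next
  case True
  then show ?thesis by (simp add: scaleR_conv_of_real)
qed

lemma absolutely_integrable_mult_continuous:
  fixes g \<phi> :: "real \<Rightarrow> complex"
  assumes "g absolutely_integrable_on {a..b}" "continuous_on {a..b} \<phi>"
  shows "(\<lambda>x. g x * \<phi> x) absolutely_integrable_on {a..b}"
proof -
  have "(\<lambda>x. \<phi> x * g x) absolutely_integrable_on {a..b}"
    using assms
    by (intro absolutely_integrable_bounded_measurable_product[OF bilinear_times])
       (auto intro: continuous_imp_measurable_on_sets_lebesgue compact_imp_bounded compact_continuous_image)
  then show ?thesis by (simp add: mult.commute)
qed

lemma integrable_mult_continuous:
  fixes g \<phi> :: "real \<Rightarrow> complex"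
  assumes "g absolutely_integrable_on {a..b}" "continuous_on {a..b} \<phi>"
  shows "(\<lambda>x. g x * \<phi> x) integrable_on {a..b}"
  using absolutely_integrable_mult_continuous[OF assms] absolutely_integrable_on_def by blast

lemma continuous_absolutely_integrable:
  fixes g :: "real \<Rightarrow> complex"
  assumes "continuous_on UNIV g"
  shows "g absolutely_integrable_on {a..b}"
  by (intro absolutely_integrable_continuous_real continuous_on_subset[OF assms]) auto

lemma fourier_coeff_trig_sum:
  assumes "finite K"
  shows "fourier_coeff (trig_sum K c) k = (if k \<in> K then c k else 0)"
proof -
  have "integral {0..2 * pi} (\<lambda>x. trig_sum K c x * cis (- (of_int k * x)))
      = integral {0..2 * pi} (\<lambda>x. \<Sum>j\<in>K. c j * cis (of_int (j - k) * x))"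
    unfolding trig_sum_def sum_distrib_right
    by (intro arg_cong[of _ _ "integral {0..2 * pi}"] ext sum.cong refl)
       (simp add: mult.assoc cis_mult left_diff_distrib)
  also have "\<dots> = (\<Sum>j\<in>K. integral {0..2 * pi} (\<lambda>x. c j * cis (of_int (j - k) * x)))"
    by (intro integral_sum assms integrable_continuous_interval continuous_intros)
  also have "\<dots> = (\<Sum>j\<in>K. if j = k then c k * (2 * pi) else 0)"
    by (intro sum.cong refl) (simp add: integral_cis_int del: of_int_diff)
  also have "\<dots> = (if k \<in> K then c k * (2 * pi) else 0)"
    using assms by simp
  finally show ?thesis by (simp add: fourier_coeff_def)
qed

lemma fourier_coeff_diff:
  assumes "g absolutely_integrable_on {0..2 * pi}" "h absolutely_integrable_on {0..2 * pi}"
  shows "fourier_coeff (\<lambda>x. g x - h x) k = fourier_coeff g k - fourier_coeff h k"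
  unfolding fourier_coeff_def left_diff_distrib
  by (subst Henstock_Kurzweil_Integration.integral_diff)
     (auto intro!: integrable_mult_continuous assms continuous_intros simp: diff_divide_distrib)

lemma fourier_coeff_mult: "fourier_coeff (\<lambda>x. a * g x) k = a * fourier_coeff g k"
  by (simp add: fourier_coeff_def mult.assoc)

lemma norm_fourier_coeff_le:
  assumes "continuous_on {0..2 * pi} g" "\<And>x. x \<in> {0..2 * pi} \<Longrightarrow> cmod (g x) \<le> B"
  shows "cmod (fourier_coeff g k) \<le> B"
proof -
  have "cmod (integral {0..2 * pi} (\<lambda>x. g x * cis (- (of_int k * x)))) \<le> B * (2 * pi - 0)"
    using assms by (intro integral_bound continuous_intros) (auto simp: norm_mult)
  then show ?thesis by (simp add: fourier_coeff_def norm_divide field_simps)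
qed

lemma tendsto_fourier_coeff:
  assumes lim: "uniform_limit UNIV u v sequentially"
    and cont: "\<And>n. continuous_on UNIV (u n)"
  shows "(\<lambda>n. fourier_coeff (u n) k) \<longlonglongrightarrow> fourier_coeff v k"
proof (rule LIMSEQ_I)
  fix e :: real assume e: "e > 0"
  have v: "continuous_on UNIV v"
    using uniform_limit_theorem[OF always_eventually lim] cont by auto
  obtain N where N: "\<And>n x. n \<ge> N \<Longrightarrow> dist (u n x) (v x) < e / 2"
    using lim e unfolding uniform_limit_sequentially_iff by (meson half_gt_zero UNIV_I)
  have "norm (fourier_coeff (u n) k - fourier_coeff v k) < e" if "n \<ge> N" for n
  proof -
    have "cmod (fourier_coeff (\<lambda>x. u n x - v x) k) \<le> e / 2"
      using N[OF that] by (intro norm_fourier_coeff_le continuous_intros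
          continuous_on_subset[OF v] continuous_on_subset[OF cont]) (auto simp: dist_norm less_imp_le)
    then show ?thesis
      using e by (subst (asm) fourier_coeff_diff) (auto intro: continuous_absolutely_integrable cont v)
  qed
  then show "\<exists>N. \<forall>n\<ge>N. norm (fourier_coeff (u n) k - fourier_coeff v k) < e" by blast
qed

lemma sum_fourier_coeff_mult_cnj:
  assumes "finite K" "g absolutely_integrable_on {0..2 * pi}"
  shows "(\<Sum>k\<in>K. fourier_coeff g k * cnj (c k))
       = integral {0..2 * pi} (\<lambda>x. g x * cnj (trig_sum K c x)) / (2 * pi)"
proof -
  have "integral {0..2 * pi} (\<lambda>x. g x * cnj (trig_sum K c x))
      = integral {0..2 * pi} (\<lambda>x. \<Sum>k\<in>K. (g x * cis (- (of_int k * x))) * cnj (c k))"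
    by (simp add: trig_sum_def sum_distrib_left cis_cnj mult_ac)
  also have "\<dots> = (\<Sum>k\<in>K. integral {0..2 * pi} (\<lambda>x. (g x * cis (- (of_int k * x))) * cnj (c k)))"
    using assms by (intro integral_sum integrable_on_mult_left integrable_mult_continuous continuous_intros) auto
  finally show ?thesis
    by (simp add: fourier_coeff_def sum_divide_distrib)
qed

lemma integral_of_real_complex:
  fixes g :: "real \<Rightarrow> real"
  assumes "g integrable_on S"
  shows "integral S (\<lambda>x. complex_of_real (g x)) = of_real (integral S g)"
  by (rule integral_unique[OF has_integral_of_real[OF integrable_integral[OF assms]]])

text \<open>
  Parseval for finite sums is the pairing formula applied to the sum itself, whose Fourier coefficients are known.
\<close>

lemma parseval_trig_sum:
  assumes "finite K"
  shows "integral {0..2 * pi} (\<lambda>x. (cmod (trig_sum K c x))\<^sup>2) = 2 * pi * (\<Sum>k\<in>K. (cmod (c k))\<^sup>2)"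
proof -
  have "complex_of_real (\<Sum>k\<in>K. (cmod (c k))\<^sup>2) = (\<Sum>k\<in>K. fourier_coeff (trig_sum K c) k * cnj (c k))"
    using assms by (simp add: fourier_coeff_trig_sum complex_norm_square del: of_real_power)
  also have "\<dots> = integral {0..2 * pi} (\<lambda>x. complex_of_real ((cmod (trig_sum K c x))\<^sup>2)) / (2 * pi)"
    unfolding complex_norm_square using assms
    by (intro sum_fourier_coeff_mult_cnj continuous_absolutely_integrable continuous_trig_sum)
  also have "integral {0..2 * pi} (\<lambda>x. complex_of_real ((cmod (trig_sum K c x))\<^sup>2))
      = of_real (integral {0..2 * pi} (\<lambda>x. (cmod (trig_sum K c x))\<^sup>2))"
    by (intro integral_of_real_complex integrable_continuous_interval continuous_intros)
  also have "\<dots> / (2 * pi) = of_real (integral {0..2 * pi} (\<lambda>x. (cmod (trig_sum K c x))\<^sup>2) / (2 * pi))"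
    by simp
  finally have "(\<Sum>k\<in>K. (cmod (c k))\<^sup>2) = integral {0..2 * pi} (\<lambda>x. (cmod (trig_sum K c x))\<^sup>2) / (2 * pi)"
    unfolding of_real_eq_iff .
  then show ?thesis by simp
qed

text \<open>
  Telescoping, because \<open>1 / (M + 1)\<^sup>2 \<le> 1 / M - 1 / (M + 1)\<close>.
\<close>

lemma sum_inverse_squares_le:
  assumes "0 < m" "m \<le> M"
  shows "(\<Sum>n\<in>{m<..M}. 1 / (real n)\<^sup>2) \<le> 1 / real m - 1 / real M"
  using assms(2)
proof (induction M rule: dec_induct)
  case (step M)
  have M: "M > 0" using step assms by linarith
  have "1 / (real (Suc M))\<^sup>2 \<le> 1 / (real M * real (Suc M))"
    using M by (intro divide_left_mono) (auto simp: power2_eq_square)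
  also have "\<dots> = 1 / real M - 1 / real (Suc M)"
    using M by (simp add: field_simps)
  finally have "1 / (real (Suc M))\<^sup>2 \<le> 1 / real M - 1 / real (Suc M)" .
  moreover have "{m<..Suc M} = insert (Suc M) {m<..M}" using step by auto
  ultimately show ?case using step by simp
qed simp

lemma sum_inverse_squares_int_le:
  assumes "finite K" "0 < m" "\<And>k. k \<in> K \<Longrightarrow> int m < \<bar>k\<bar>"
  shows "(\<Sum>k\<in>K. 1 / (real_of_int k)\<^sup>2) \<le> 2 / real m"
proof -
  define M where "M = Max (insert m ((nat \<circ> abs) ` K))"
  have M: "m \<le> M" "\<And>k. k \<in> K \<Longrightarrow> nat \<bar>k\<bar> \<le> M"
    using assms(1) by (auto simp: M_def)
  have *: "(\<Sum>k\<in>L. 1 / (real_of_int k)\<^sup>2) \<le> 1 / real m" if L: "L \<subseteq> K" "inj_on (nat \<circ> abs) L" for L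
  proof -
    have "(\<Sum>k\<in>L. 1 / (real_of_int k)\<^sup>2) = (\<Sum>n\<in>(nat \<circ> abs) ` L. 1 / (real n)\<^sup>2)"
      using L(2) by (subst sum.reindex) (auto simp: power2_eq_square)
    also have "\<dots> \<le> (\<Sum>n\<in>{m<..M}. 1 / (real n)\<^sup>2)"
      using L(1) M assms(3) by (intro sum_mono2) (force simp: zless_nat_eq_int_zless)+
    also have "\<dots> \<le> 1 / real m - 1 / real M"
      using assms(2) M(1) by (rule sum_inverse_squares_le)
    finally show ?thesis using divide_nonneg_nonneg[of 1 "real M"] by linarith
  qed
  have "K = {k\<in>K. k > 0} \<union> {k\<in>K. k < 0}" using assms(2,3) by force
  then have "(\<Sum>k\<in>K. 1 / (real_of_int k)\<^sup>2)
      = (\<Sum>k\<in>{k\<in>K. k > 0} \<union> {k\<in>K. k < 0}. 1 / (real_of_int k)\<^sup>2)"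
    by (rule sum.cong) (rule refl)
  also have "\<dots> = (\<Sum>k\<in>{k\<in>K. k > 0}. 1 / (real_of_int k)\<^sup>2) + (\<Sum>k\<in>{k\<in>K. k < 0}. 1 / (real_of_int k)\<^sup>2)"
    using assms(1) by (intro sum.union_disjoint) auto
  also have "\<dots> \<le> 1 / real m + 1 / real m"
    by (intro add_mono *) (auto simp: inj_on_def)
  finally show ?thesis by simp
qed

text \<open>
  Cauchy-Schwarz with the weights \<open>1/k\<close> and \<open>k\<close>.  Since \<open>\<Sum>1/k\<^sup>2\<close> converges, a bound on the derivative makes the
  contribution of the modes beyond \<open>m\<close> to the supremum norm small, uniformly in \<open>K\<close>.
\<close>

lemma high_modes_small:
  assumes "finite K" "0 < m" "\<And>k. k \<in> K \<Longrightarrow> int m < \<bar>k\<bar>"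
  shows "(\<Sum>k\<in>K. cmod (c k))\<^sup>2 \<le> 2 / real m * (\<Sum>k\<in>K. (real_of_int k)\<^sup>2 * (cmod (c k))\<^sup>2)"
proof -
  have "0 \<notin> K" using assms(3)[of 0] by auto
  then have "(\<Sum>k\<in>K. cmod (c k))\<^sup>2 = (\<Sum>k\<in>K. (1 / real_of_int k) * (real_of_int k * cmod (c k)))\<^sup>2"
    by (intro arg_cong[of _ _ "\<lambda>x. x\<^sup>2"] sum.cong) auto
  also have "\<dots> \<le> (\<Sum>k\<in>K. (1 / real_of_int k)\<^sup>2) * (\<Sum>k\<in>K. (real_of_int k * cmod (c k))\<^sup>2)"
    by (rule Cauchy_Schwarz_ineq_sum)
  also have "\<dots> \<le> 2 / real m * (\<Sum>k\<in>K. (real_of_int k * cmod (c k))\<^sup>2)"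
    using sum_inverse_squares_int_le[OF assms]
    by (intro mult_right_mono sum_nonneg) (auto simp: power_one_over)
  finally show ?thesis by (simp add: power_mult_distrib)
qed

text \<open>
  The elementary substitute for the Gagliardo-Nirenberg inequality: the at most \<open>2m + 1\<close> low modes are
  controlled by the \<open>L\<^sup>2\<close> norm, the others by \<open>high_modes_small\<close>.  A large \<open>m\<close> puts an arbitrarily small
  factor in front of the derivative.
\<close>

lemma sum_coeffs_interpolation:
  assumes "finite K" "0 < m"
  shows "(\<Sum>k\<in>K. cmod (c k))\<^sup>2 \<le> 2 * (2 * real m + 1) * (\<Sum>k\<in>K. (cmod (c k))\<^sup>2)
             + 4 / real m * (\<Sum>k\<in>K. (real_of_int k)\<^sup>2 * (cmod (c k))\<^sup>2)"
proof -
  define L where "L = K \<inter> {- int m..int m}"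
  define H where "H = K - {- int m..int m}"
  have fin: "finite L" "finite H" using assms by (auto simp: L_def H_def)
  have "(\<Sum>k\<in>L. cmod (c k))\<^sup>2 \<le> (\<Sum>k\<in>L. 1\<^sup>2) * (\<Sum>k\<in>L. (cmod (c k))\<^sup>2)"
    using Cauchy_Schwarz_ineq_sum[of "\<lambda>_. 1" "\<lambda>k. cmod (c k)" L] by simp
  also have "\<dots> \<le> (2 * real m + 1) * (\<Sum>k\<in>K. (cmod (c k))\<^sup>2)"
  proof (intro mult_mono sum_mono2 sum_nonneg)
    have "card L \<le> card {- int m..int m}" by (intro card_mono) (auto simp: L_def)
    then show "(\<Sum>k\<in>L. 1\<^sup>2) \<le> 2 * real m + 1" by simp
  qed (use assms in \<open>auto simp: L_def\<close>)
  finally have low: "(\<Sum>k\<in>L. cmod (c k))\<^sup>2 \<le> (2 * real m + 1) * (\<Sum>k\<in>K. (cmod (c k))\<^sup>2)" .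
  have "(\<Sum>k\<in>H. cmod (c k))\<^sup>2 \<le> 2 / real m * (\<Sum>k\<in>H. (real_of_int k)\<^sup>2 * (cmod (c k))\<^sup>2)"
    using fin assms by (intro high_modes_small) (auto simp: H_def)
  also have "\<dots> \<le> 2 / real m * (\<Sum>k\<in>K. (real_of_int k)\<^sup>2 * (cmod (c k))\<^sup>2)"
    using assms by (intro mult_left_mono sum_mono2) (auto simp: H_def)
  finally have high: "(\<Sum>k\<in>H. cmod (c k))\<^sup>2 \<le> \<dots>" .
  have "(\<Sum>k\<in>K. cmod (c k)) = (\<Sum>k\<in>L. cmod (c k)) + (\<Sum>k\<in>H. cmod (c k))"
    using assms by (subst sum.union_disjoint[symmetric]) (auto simp: L_def H_def intro: sum.cong)
  moreover have "(a + b)\<^sup>2 \<le> 2 * a\<^sup>2 + 2 * b\<^sup>2" for a b :: real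
    using sum_squares_bound[of a b] by (simp add: power2_sum)
  ultimately have "(\<Sum>k\<in>K. cmod (c k))\<^sup>2 \<le> 2 * (\<Sum>k\<in>L. cmod (c k))\<^sup>2 + 2 * (\<Sum>k\<in>H. cmod (c k))\<^sup>2"
    by simp
  then have "(\<Sum>k\<in>K. cmod (c k))\<^sup>2 \<le> 2 * ((2 * real m + 1) * (\<Sum>k\<in>K. (cmod (c k))\<^sup>2))
      + 2 * (2 / real m * (\<Sum>k\<in>K. (real_of_int k)\<^sup>2 * (cmod (c k))\<^sup>2))"
    using low high by linarith
  moreover have "2 * (2 / real m * b) = 4 / real m * b"
    "2 * ((2 * real m + 1) * b) = 2 * (2 * real m + 1) * b" for b by simp_all
  ultimately show ?thesis by (simp only:)
qed

section \<open>The truncated equations: solutions and bounds\<close>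

definition cubic :: "complex \<Rightarrow> complex" where
  "cubic z = of_real ((cmod z)\<^sup>2) * z"

lemma cubic_altdef: "cubic z = z * cnj z * z"
  by (simp add: cubic_def complex_norm_square del: of_real_power)

lemma continuous_on_cubic [continuous_intros]:
  "continuous_on S g \<Longrightarrow> continuous_on S (\<lambda>x. cubic (g x))"
  unfolding cubic_def by (intro continuous_intros)

lemma uniform_limit_cubic:
  assumes "uniform_limit S u v F" "bounded (v ` S)"
  shows "uniform_limit S (\<lambda>n x. cubic (u n x)) (\<lambda>x. cubic (v x)) F"
proof -
  have c: "uniform_limit S (\<lambda>n x. cnj (u n x)) (\<lambda>x. cnj (v x)) F"
    by (rule bounded_linear.uniform_limit[OF bounded_linear_cnj assms(1)])
  obtain B where B: "\<And>x. x \<in> S \<Longrightarrow> cmod (v x) \<le> B"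
    using assms(2) unfolding bounded_iff by auto
  have "bounded ((\<lambda>x. cnj (v x)) ` S)"
    unfolding bounded_iff by (auto intro!: exI[of _ B] B)
  moreover have "bounded ((\<lambda>x. v x * cnj (v x)) ` S)"
    unfolding bounded_iff
    by (auto intro!: exI[of _ "B * B"] mult_mono B intro: order_trans[OF norm_ge_zero B] simp: norm_mult)
  ultimately show ?thesis
    unfolding cubic_altdef by (intro uniform_lim_mult assms c)
qed

lemma norm_trig_sum_diff_le:
  "cmod (trig_sum K c x - trig_sum K c' x) \<le> (\<Sum>k\<in>K. cmod (c k - c' k))"
  using norm_trig_sum_le[of K "\<lambda>k. c k - c' k" x]
  by (simp add: trig_sum_def sum_subtractf left_diff_distrib)

lemma uniform_limit_trig_sum:
  assumes "\<And>k. k \<in> K \<Longrightarrow> (\<lambda>n. X n k) \<longlonglongrightarrow> c k"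
  shows "uniform_limit UNIV (\<lambda>n. trig_sum K (X n)) (trig_sum K c) sequentially"
proof (rule uniform_limitI)
  fix e :: real assume "e > 0"
  moreover have "(\<lambda>n. \<Sum>k\<in>K. cmod (X n k - c k)) \<longlonglongrightarrow> (\<Sum>k\<in>K. cmod (c k - c k))"
    by (intro tendsto_intros assms)
  ultimately have "\<forall>\<^sub>F n in sequentially. (\<Sum>k\<in>K. cmod (X n k - c k)) < e"
    by (simp add: order_tendstoD)
  then show "\<forall>\<^sub>F n in sequentially. \<forall>x\<in>UNIV. dist (trig_sum K (X n) x) (trig_sum K c x) < e"
    by eventually_elim (auto simp: dist_norm intro: le_less_trans[OF norm_trig_sum_diff_le])
qed

lemma bounded_trig_sum: "bounded (range (trig_sum K c))"
  unfolding bounded_iff using norm_trig_sum_le by blast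

text \<open>
  Young's inequality under the integral.  It suffices for the energy argument and avoids the
  Cauchy-Schwarz inequality for integrals.
\<close>

lemma norm_forcing_pairing_le:
  assumes K: "finite K" and f: "f absolutely_integrable_on {0..2 * pi}"
    and f2: "(\<lambda>x. (cmod (f x))\<^sup>2) integrable_on {0..2 * pi}"
  shows "cmod (\<Sum>k\<in>K. fourier_coeff f k * cnj (c k))
       \<le> (integral {0..2 * pi} (\<lambda>x. (cmod (f x))\<^sup>2) / (2 * pi) + (\<Sum>k\<in>K. (cmod (c k))\<^sup>2)) / 2"
proof -
  let ?u = "trig_sum K c"
  have u2: "(\<lambda>x. (cmod (?u x))\<^sup>2) integrable_on {0..2 * pi}"
    by (intro integrable_continuous_interval continuous_intros)
  have "cmod (integral {0..2 * pi} (\<lambda>x. f x * cnj (?u x)))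
      \<le> integral {0..2 * pi} (\<lambda>x. ((cmod (f x))\<^sup>2 + (cmod (?u x))\<^sup>2) / 2)"
  proof (rule integral_norm_bound_integral)
    show "(\<lambda>x. f x * cnj (?u x)) integrable_on {0..2 * pi}"
      by (intro integrable_mult_continuous f continuous_intros)
    show "(\<lambda>x. ((cmod (f x))\<^sup>2 + (cmod (?u x))\<^sup>2) / 2) integrable_on {0..2 * pi}"
      by (intro integrable_on_divide Henstock_Kurzweil_Integration.integrable_add f2 u2)
    show "cmod (f x * cnj (?u x)) \<le> ((cmod (f x))\<^sup>2 + (cmod (?u x))\<^sup>2) / 2" for x
      using sum_squares_bound[of "cmod (f x)" "cmod (?u x)"] by (simp add: norm_mult)
  qed
  also have "\<dots> = (integral {0..2 * pi} (\<lambda>x. (cmod (f x))\<^sup>2)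
      + 2 * pi * (\<Sum>k\<in>K. (cmod (c k))\<^sup>2)) / 2"
    by (simp add: Henstock_Kurzweil_Integration.integral_add f2 u2 parseval_trig_sum K)
  finally show ?thesis
    unfolding sum_fourier_coeff_mult_cnj[OF K f] by (simp add: norm_divide field_simps)
qed

text \<open>
  The pairing of the cubic term with \<open>u\<close> is real.  This is why the nonlinearity drops out of the
  \<open>L\<^sup>2\<close> estimate, irrespective of its size.
\<close>

lemma cubic_pairing:
  fixes c :: "int \<Rightarrow> complex"
  assumes K: "finite K"
  defines "Q \<equiv> integral {0..2 * pi} (\<lambda>x. (cmod (trig_sum K c x)) ^ 4) / (2 * pi)"
  shows "(\<Sum>k\<in>K. fourier_coeff (\<lambda>x. cubic (trig_sum K c x)) k * cnj (c k)) = of_real Q"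
    and "0 \<le> Q" and "Q \<le> (\<Sum>k\<in>K. cmod (c k))\<^sup>2 * (\<Sum>k\<in>K. (cmod (c k))\<^sup>2)"
proof -
  let ?u = "trig_sum K c" and ?S = "\<Sum>k\<in>K. cmod (c k)"
  have *: "cubic z * cnj z = of_real (cmod z ^ 4)" for z
  proof -
    have "cubic z * cnj z = (z * cnj z) * (z * cnj z)" by (simp add: cubic_altdef)
    also have "\<dots> = of_real ((cmod z)\<^sup>2 * (cmod z)\<^sup>2)" by (simp flip: complex_norm_square)
    finally show ?thesis by (simp add: power4_eq_xxxx power2_eq_square mult.assoc)
  qed
  have cont: "(\<lambda>x. (cmod (?u x)) ^ n) integrable_on {0..2 * pi}" for n
    by (intro integrable_continuous_interval continuous_intros)
  have "(\<Sum>k\<in>K. fourier_coeff (\<lambda>x. cubic (trig_sum K c x)) k * cnj (c k))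
     = integral {0..2 * pi} (\<lambda>x. complex_of_real ((cmod (?u x)) ^ 4)) / (2 * pi)"
    unfolding *[symmetric]
    by (intro sum_fourier_coeff_mult_cnj K continuous_absolutely_integrable continuous_intros)
  also have "integral {0..2 * pi} (\<lambda>x. complex_of_real ((cmod (?u x)) ^ 4))
      = of_real (integral {0..2 * pi} (\<lambda>x. (cmod (?u x)) ^ 4))"
    by (rule integral_of_real_complex[OF cont])
  also have "\<dots> / (2 * pi) = of_real Q" by (simp add: Q_def)
  finally show "(\<Sum>k\<in>K. fourier_coeff (\<lambda>x. cubic (trig_sum K c x)) k * cnj (c k)) = of_real Q" .
  show "0 \<le> Q"
    unfolding Q_def by (intro divide_nonneg_nonneg Henstock_Kurzweil_Integration.integral_nonneg cont) auto
  have "integral {0..2 * pi} (\<lambda>x. (cmod (?u x)) ^ 4) \<le> integral {0..2 * pi} (\<lambda>x. ?S\<^sup>2 * (cmod (?u x))\<^sup>2)"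
  proof (rule integral_le)
    show "(\<lambda>x. ?S\<^sup>2 * (cmod (?u x))\<^sup>2) integrable_on {0..2 * pi}"
      using cont by (intro integrable_on_mult_right)
    show "cmod (?u x) ^ 4 \<le> ?S\<^sup>2 * (cmod (?u x))\<^sup>2" for x
    proof -
      have "cmod (?u x) ^ 4 = (cmod (?u x))\<^sup>2 * (cmod (?u x))\<^sup>2"
        by (simp flip: power_add)
      also have "\<dots> \<le> ?S\<^sup>2 * (cmod (?u x))\<^sup>2"
        by (intro mult_right_mono power_mono norm_trig_sum_le) auto
      finally show ?thesis .
    qed
  qed (rule cont)
  also have "\<dots> = ?S\<^sup>2 * (2 * pi * (\<Sum>k\<in>K. (cmod (c k))\<^sup>2))"
    by (simp add: parseval_trig_sum K)
  finally show "Q \<le> ?S\<^sup>2 * (\<Sum>k\<in>K. (cmod (c k))\<^sup>2)"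
    by (simp add: Q_def field_simps)
qed

text \<open>
  After multiplication by \<open>\<i>\<close> the damping \<open>Im l\<^sub>k = - 1\<close> makes the truncated vector field point outwards on the
  sphere of squared radius \<open>A + 1\<close>, where \<open>A\<close> is the mean of \<open>|f|\<^sup>2\<close>: its real pairing with \<open>c\<close> is at least
  \<open>(A + 1) - (A + (A + 1)) / 2\<close>, which is positive.
\<close>

lemma galerkin_solution:
  fixes l :: "int \<Rightarrow> complex"
  assumes K: "finite K" and f: "f absolutely_integrable_on {0..2 * pi}"
    and f2: "(\<lambda>x. (cmod (f x))\<^sup>2) integrable_on {0..2 * pi}"
    and l: "\<And>k. Im (l k) = - 1"
  obtains c where "(\<Sum>k\<in>K. (cmod (c k))\<^sup>2) \<le> integral {0..2 * pi} (\<lambda>x. (cmod (f x))\<^sup>2) / (2 * pi) + 1"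
    and "\<And>k. k \<in> K \<Longrightarrow> l k * c k = fourier_coeff (\<lambda>x. cubic (trig_sum K c x)) k - \<i> * fourier_coeff f k"
proof -
  define A where "A = integral {0..2 * pi} (\<lambda>x. (cmod (f x))\<^sup>2) / (2 * pi)"
  have A: "A \<ge> 0"
    unfolding A_def by (intro divide_nonneg_nonneg Henstock_Kurzweil_Integration.integral_nonneg f2) auto
  define G where "G c k = \<i> * (l k * c k - fourier_coeff (\<lambda>x. cubic (trig_sum K c x)) k
                            + \<i> * fourier_coeff f k)" for c k
  obtain c where c: "(\<Sum>i\<in>K. (cmod (c i))\<^sup>2) \<le> (sqrt (A + 1))\<^sup>2" "\<And>i. i \<in> K \<Longrightarrow> G c i = 0"
  proof (rule exists_complex_zero_in_ball[OF K, of "sqrt (A + 1)" G])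
    show "0 < sqrt (A + 1)" using A by simp
  next
    fix X :: "nat \<Rightarrow> int \<Rightarrow> complex" and c :: "int \<Rightarrow> complex" and k
    assume X: "\<And>j. j \<in> K \<Longrightarrow> (\<lambda>p. X p j) \<longlonglongrightarrow> c j" and k: "k \<in> K"
    have "(\<lambda>p. fourier_coeff (\<lambda>x. cubic (trig_sum K (X p) x)) k)
        \<longlonglongrightarrow> fourier_coeff (\<lambda>x. cubic (trig_sum K c x)) k"
      by (intro tendsto_fourier_coeff uniform_limit_cubic uniform_limit_trig_sum X bounded_trig_sum
            continuous_intros)
    then show "(\<lambda>p. G (X p) k) \<longlonglongrightarrow> G c k"
      unfolding G_def by (intro tendsto_intros X k)
  next
    fix c :: "int \<Rightarrow> complex"
    assume "(\<Sum>i\<in>K. (cmod (c i))\<^sup>2) = (sqrt (A + 1))\<^sup>2"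
    with A have n: "(\<Sum>i\<in>K. (cmod (c i))\<^sup>2) = A + 1" by simp
    let ?N = "\<Sum>k\<in>K. fourier_coeff (\<lambda>x. cubic (trig_sum K c x)) k * cnj (c k)"
    let ?F = "\<Sum>k\<in>K. fourier_coeff f k * cnj (c k)"
    have "G c k * cnj (c k) = \<i> * l k * of_real ((cmod (c k))\<^sup>2)
        - \<i> * (fourier_coeff (\<lambda>x. cubic (trig_sum K c x)) k * cnj (c k))
        - fourier_coeff f k * cnj (c k)" for k
      unfolding complex_norm_square G_def by (simp add: algebra_simps)
    then have "(\<Sum>k\<in>K. G c k * cnj (c k))
        = (\<Sum>k\<in>K. \<i> * l k * of_real ((cmod (c k))\<^sup>2)) - \<i> * ?N - ?F"
      by (simp add: sum_subtractf sum_distrib_left del: of_real_power)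
    moreover have "Re (\<Sum>k\<in>K. \<i> * l k * of_real ((cmod (c k))\<^sup>2)) = A + 1"
      using n l by (simp del: of_real_power)
    moreover have "Re (\<i> * ?N) = 0" by (simp add: cubic_pairing(1)[OF K])
    moreover have "Re ?F \<le> (A + (A + 1)) / 2"
      using norm_forcing_pairing_le[OF K f f2, of c] complex_Re_le_cmod[of ?F]
      unfolding n A_def[symmetric] by linarith
    ultimately show "0 \<le> Re (\<Sum>k\<in>K. G c k * cnj (c k))" by simp
  qed blast
  show thesis
  proof
    show "(\<Sum>k\<in>K. (cmod (c k))\<^sup>2) \<le> integral {0..2 * pi} (\<lambda>x. (cmod (f x))\<^sup>2) / (2 * pi) + 1"
      using c(1) A by (simp add: A_def)
    show "l k * c k = fourier_coeff (\<lambda>x. cubic (trig_sum K c x)) k - \<i> * fourier_coeff f k"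
      if "k \<in> K" for k
    proof -
      have "l k * c k - fourier_coeff (\<lambda>x. cubic (trig_sum K c x)) k + \<i> * fourier_coeff f k = 0"
        using c(2)[OF that] unfolding G_def mult_eq_0_iff by simp
      then show ?thesis by (simp add: algebra_simps)
    qed
  qed
qed

text \<open>
  The real part of the energy identity expresses \<open>d \<Sum>k\<^sup>2|c\<^sub>k|\<^sup>2\<close> through the quartic term, the forcing and terms
  of lower order.  Both the quartic term and the first-order term are absorbed at the cost of a quarter of
  \<open>|d| \<Sum>k\<^sup>2|c\<^sub>k|\<^sup>2\<close> each.  The bound \<open>M\<close> does not depend on the set of modes.
\<close>

lemma galerkin_derivative_bound:
  fixes d \<omega> \<zeta> A R :: real
  assumes d: "d \<noteq> 0" and R: "R \<ge> 0"
  obtains M where "\<And>K c f. finite K \<Longrightarrow> f absolutely_integrable_on {0..2 * pi} \<Longrightarrow>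
       (\<lambda>x. (cmod (f x))\<^sup>2) integrable_on {0..2 * pi} \<Longrightarrow>
       integral {0..2 * pi} (\<lambda>x. (cmod (f x))\<^sup>2) / (2 * pi) \<le> A \<Longrightarrow>
       (\<Sum>k\<in>K. (cmod (c k))\<^sup>2) \<le> R \<Longrightarrow>
       (\<And>k. k \<in> K \<Longrightarrow> (of_real (d * (real_of_int k)\<^sup>2 - \<omega> * of_int k + \<zeta>) - \<i>) * c k =
             fourier_coeff (\<lambda>x. cubic (trig_sum K c x)) k - \<i> * fourier_coeff f k) \<Longrightarrow>
       (\<Sum>k\<in>K. (real_of_int k)\<^sup>2 * (cmod (c k))\<^sup>2) \<le> M"
proof -
  \<comment> \<open>With this cutoff, \<open>4 R / m \<le> |d| / 4\<close>, so the quartic term is absorbed.\<close>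
  obtain m :: nat where m1: "16 * R / \<bar>d\<bar> < real m"
    using reals_Archimedean2 by blast
  have "0 \<le> 16 * R / \<bar>d\<bar>" using R by simp
  with m1 have "0 < m" by linarith
  note m = m1 this
  define M where "M = 2 / \<bar>d\<bar> * (\<omega>\<^sup>2 / \<bar>d\<bar> * R + \<bar>\<zeta>\<bar> * R + 2 * (2 * real m + 1) * R * R + (A + R) / 2)"
  show thesis
  proof (rule that[of M])
    fix K c f
    assume K: "finite K" and f: "f absolutely_integrable_on {0..2 * pi}"
      and f2: "(\<lambda>x. (cmod (f x))\<^sup>2) integrable_on {0..2 * pi}"
      and fA: "integral {0..2 * pi} (\<lambda>x. (cmod (f x))\<^sup>2) / (2 * pi) \<le> A"
      and cR: "(\<Sum>k\<in>K. (cmod (c k))\<^sup>2) \<le> R"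
      and eq: "\<And>k. k \<in> K \<Longrightarrow> (of_real (d * (real_of_int k)\<^sup>2 - \<omega> * of_int k + \<zeta>) - \<i>) * c k =
             fourier_coeff (\<lambda>x. cubic (trig_sum K c x)) k - \<i> * fourier_coeff f k"
    define S where "S = (\<Sum>k\<in>K. (cmod (c k))\<^sup>2)"
    define D where "D = (\<Sum>k\<in>K. (real_of_int k)\<^sup>2 * (cmod (c k))\<^sup>2)"
    have S: "0 \<le> S" "S \<le> R" using cR by (auto simp: S_def sum_nonneg)
    have D: "0 \<le> D" by (simp add: D_def sum_nonneg)
    define Q where "Q = integral {0..2 * pi} (\<lambda>x. (cmod (trig_sum K c x)) ^ 4) / (2 * pi)"
    let ?F = "\<Sum>k\<in>K. fourier_coeff f k * cnj (c k)"
    have "(of_real (d * (real_of_int k)\<^sup>2 - \<omega> * of_int k + \<zeta>) - \<i>) * of_real ((cmod (c k))\<^sup>2)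
        = fourier_coeff (\<lambda>x. cubic (trig_sum K c x)) k * cnj (c k) - \<i> * (fourier_coeff f k * cnj (c k))"
      if "k \<in> K" for k
      using arg_cong[OF eq[OF that], of "\<lambda>z. z * cnj (c k)"] unfolding complex_norm_square
      by (simp add: algebra_simps)
    then have "(\<Sum>k\<in>K. (of_real (d * (real_of_int k)\<^sup>2 - \<omega> * of_int k + \<zeta>) - \<i>) * of_real ((cmod (c k))\<^sup>2))
        = of_real Q - \<i> * ?F"
      unfolding Q_def cubic_pairing(1)[OF K, symmetric] by (simp add: sum_subtractf sum_distrib_left)
    from arg_cong[OF this, of Re]
    have energy: "(\<Sum>k\<in>K. (d * (real_of_int k)\<^sup>2 - \<omega> * of_int k + \<zeta>) * (cmod (c k))\<^sup>2) = Q + Im ?F"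
      by (simp del: of_real_power)
    define W where "W = (\<Sum>k\<in>K. \<omega> * of_int k * (cmod (c k))\<^sup>2)"
    have dD: "d * D = (\<Sum>k\<in>K. (d * (real_of_int k)\<^sup>2 - \<omega> * of_int k + \<zeta>) * (cmod (c k))\<^sup>2) + W - \<zeta> * S"
      unfolding D_def S_def W_def sum_distrib_left sum.distrib[symmetric] sum_subtractf[symmetric]
      by (intro sum.cong refl) (simp add: algebra_simps)
    have "\<bar>d\<bar> * D = \<bar>d * D\<bar>" using D by (simp add: abs_mult)
    also have "\<dots> = \<bar>Q + Im ?F + W - \<zeta> * S\<bar>" by (simp only: dD energy)
    also have "\<dots> \<le> Q + cmod ?F + \<bar>W\<bar> + \<bar>\<zeta>\<bar> * S"
    proof -
      have "\<bar>\<zeta> * S\<bar> = \<bar>\<zeta>\<bar> * S" using S by (simp add: abs_mult)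
      then show ?thesis
        using abs_Im_le_cmod[of ?F] cubic_pairing(2)[OF K, of c] unfolding Q_def[symmetric] by linarith
    qed
    also have "\<bar>W\<bar> \<le> (\<Sum>k\<in>K. (\<bar>d\<bar> / 4 * (real_of_int k)\<^sup>2 + \<omega>\<^sup>2 / \<bar>d\<bar>) * (cmod (c k))\<^sup>2)"
    unfolding W_def
    proof (rule order_trans[OF sum_abs], rule sum_mono)
      fix k
      \<comment> \<open>Completing the square absorbs the first-order term.\<close>
      have "0 \<le> (\<bar>d\<bar> / 2 * \<bar>real_of_int k\<bar> - \<bar>\<omega>\<bar>)\<^sup>2 / \<bar>d\<bar>" by simp
      also have "\<dots> = \<bar>d\<bar> / 4 * (real_of_int k)\<^sup>2 + \<omega>\<^sup>2 / \<bar>d\<bar> - \<bar>\<omega>\<bar> * \<bar>real_of_int k\<bar>"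
        using d by (simp add: field_simps power2_eq_square)
      finally have "\<bar>\<omega> * real_of_int k\<bar> \<le> \<bar>d\<bar> / 4 * (real_of_int k)\<^sup>2 + \<omega>\<^sup>2 / \<bar>d\<bar>"
        by (simp add: abs_mult)
      then show "\<bar>\<omega> * of_int k * (cmod (c k))\<^sup>2\<bar> \<le> (\<bar>d\<bar> / 4 * (real_of_int k)\<^sup>2 + \<omega>\<^sup>2 / \<bar>d\<bar>) * (cmod (c k))\<^sup>2"
        by (simp add: abs_mult mult_right_mono)
    qed
    also have "\<dots> = \<bar>d\<bar> / 4 * D + \<omega>\<^sup>2 / \<bar>d\<bar> * S"
      by (simp add: D_def S_def sum_distrib_left sum.distrib distrib_right mult.assoc)
    finally have 1: "\<bar>d\<bar> * D \<le> Q + cmod ?F + (\<bar>d\<bar> / 4 * D + \<omega>\<^sup>2 / \<bar>d\<bar> * S) + \<bar>\<zeta>\<bar> * S" by simp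
    have "cmod ?F \<le> (integral {0..2 * pi} (\<lambda>x. (cmod (f x))\<^sup>2) / (2 * pi) + S) / 2"
      unfolding S_def by (rule norm_forcing_pairing_le[OF K f f2])
    also have "\<dots> \<le> (A + R) / 2"
      by (intro divide_right_mono add_mono fA S) simp
    finally have 2: "cmod ?F \<le> (A + R) / 2" .
    have "Q \<le> (2 * (2 * real m + 1) * S + 4 / real m * D) * S"
      using cubic_pairing(3)[OF K, of c] sum_coeffs_interpolation[OF K m(2), of c] S
      unfolding Q_def[symmetric] S_def[symmetric] D_def[symmetric]
      by (meson mult_right_mono order_trans)
    also have "\<dots> \<le> (2 * (2 * real m + 1) * R + 4 / real m * D) * R"
      using S D R by (intro mult_mono add_mono mult_left_mono) auto
    also have "\<dots> = 2 * (2 * real m + 1) * R * R + (4 * R / real m) * D"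
      by (simp add: algebra_simps)
    also have "\<dots> \<le> 2 * (2 * real m + 1) * R * R + \<bar>d\<bar> / 4 * D"
      using m d D R by (intro add_mono mult_right_mono) (auto simp: field_simps)
    finally have 3: "Q \<le> 2 * (2 * real m + 1) * R * R + \<bar>d\<bar> / 4 * D" .
    have "\<omega>\<^sup>2 / \<bar>d\<bar> * S \<le> \<omega>\<^sup>2 / \<bar>d\<bar> * R" "\<bar>\<zeta>\<bar> * S \<le> \<bar>\<zeta>\<bar> * R"
      using S by (auto intro!: mult_left_mono divide_right_mono)
    with 1 2 3 have "\<bar>d\<bar> / 2 * D \<le> \<omega>\<^sup>2 / \<bar>d\<bar> * R + \<bar>\<zeta>\<bar> * R + 2 * (2 * real m + 1) * R * R + (A + R) / 2"
      by linarith
    also have "\<dots> = \<bar>d\<bar> / 2 * M"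
    proof -
      have "Y = \<bar>d\<bar> / 2 * (2 / \<bar>d\<bar> * Y)" for Y using d by simp
      then show ?thesis unfolding M_def .
    qed
    finally show "(\<Sum>k\<in>K. (real_of_int k)\<^sup>2 * (cmod (c k))\<^sup>2) \<le> M"
      using d unfolding D_def[symmetric] by (simp add: mult_le_cancel_left)
  qed
qed

section \<open>Passage to the limit in the truncated equations\<close>

text \<open>
  Rellich's theorem for trigonometric sums: a diagonal subsequence makes every coefficient converge, hence
  the low modes converge uniformly, while \<open>high_modes_small\<close> bounds the remainder uniformly along the
  sequence.
\<close>

lemma bounded_modes_uniformly_convergent_subsequence:
  fixes c :: "nat \<Rightarrow> int \<Rightarrow> complex"
  assumes R: "\<And>n. (\<Sum>k\<in>{- int n..int n}. (cmod (c n k))\<^sup>2) \<le> R"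
    and M: "\<And>n. (\<Sum>k\<in>{- int n..int n}. (real_of_int k)\<^sup>2 * (cmod (c n k))\<^sup>2) \<le> M"
  obtains r u where "strict_mono (r :: nat \<Rightarrow> nat)"
    and "uniform_limit UNIV (\<lambda>n. trig_sum {- int (r n)..int (r n)} (c (r n))) u sequentially"
proof -
  define a where "a n k = (if k \<in> {- int n..int n} then c n k else 0)" for n k
  have a: "norm (a n k) \<le> sqrt R" for n k
  proof (cases "k \<in> {- int n..int n}")
    case True
    then have "(cmod (c n k))\<^sup>2 \<le> R"
      using member_le_sum[of k "{- int n..int n}" "\<lambda>k. (cmod (c n k))\<^sup>2"] R[of n] by simp
    then show ?thesis using True by (simp add: a_def real_le_rsqrt)
  next
    case False
    have "0 \<le> R" using R[of 0] by (rule order_trans[rotated]) (simp add: sum_nonneg)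
    then show ?thesis using False by (auto simp: a_def)
  qed
  obtain r where r: "strict_mono r" and "\<And>k. k \<in> UNIV \<Longrightarrow> \<exists>l. (\<lambda>n. a (r n) k) \<longlonglongrightarrow> l"
    using function_convergent_subsequence[of "UNIV :: int set" a "sqrt R"] a by auto
  then have "\<forall>k. \<exists>l. (\<lambda>n. a (r n) k) \<longlonglongrightarrow> l" by simp
  from choice[OF this] obtain l where l: "\<And>k. (\<lambda>n. a (r n) k) \<longlonglongrightarrow> l k" by auto
  define v where "v n = trig_sum {- int (r n)..int (r n)} (c (r n))" for n
  have M0: "0 \<le> M" using M[of 0] by (rule order_trans[rotated]) (simp add: sum_nonneg)
  have "uniformly_Cauchy_on UNIV v"
  proof (rule uniformly_Cauchy_onI)
    fix e :: real assume e: "e > 0"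
    \<comment> \<open>The cutoff makes the modes beyond \<open>m\<close> contribute less than \<open>e / 4\<close> to the supremum norm.\<close>
    obtain m :: nat where m0: "2 * M / (e / 4)\<^sup>2 < real m"
      using reals_Archimedean2 by blast
    have "0 \<le> 2 * M / (e / 4)\<^sup>2" using M0 by simp
    with m0 have m: "0 < m" by linarith
    have mM: "2 / real m * M < (e / 4)\<^sup>2"
      using m0 m e by (simp add: field_simps)
    let ?L = "{- int m..int m}"
    have "uniform_limit UNIV (\<lambda>n. trig_sum ?L (a (r n))) (trig_sum ?L l) sequentially"
      by (intro uniform_limit_trig_sum l)
    moreover have "0 < e / 4" using e by simp
    ultimately obtain N where N: "\<And>n x. n \<ge> N \<Longrightarrow> dist (trig_sum ?L (a (r n)) x) (trig_sum ?L l x) < e / 4"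
      unfolding uniform_limit_sequentially_iff by blast
    have close: "dist (v n x) (trig_sum ?L l x) < e / 2" if n: "n \<ge> max N m" for n x
    proof -
      have "m \<le> r n" using seq_suble[OF r, of n] n by linarith
      let ?H = "{- int (r n)..int (r n)} - ?L"
      have "v n x = trig_sum (?L \<union> ?H) (c (r n)) x"
        using \<open>m \<le> r n\<close> unfolding v_def by (intro arg_cong[of _ _ "\<lambda>K. trig_sum K _ x"]) auto
      also have "\<dots> = trig_sum ?L (c (r n)) x + trig_sum ?H (c (r n)) x"
        unfolding trig_sum_def by (intro sum.union_disjoint) auto
      also have "trig_sum ?L (c (r n)) x = trig_sum ?L (a (r n)) x"
        using \<open>m \<le> r n\<close> unfolding trig_sum_def a_def by (intro sum.cong) auto
      finally have split: "v n x = trig_sum ?L (a (r n)) x + trig_sum ?H (c (r n)) x" .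
      have "(\<Sum>k\<in>?H. cmod (c (r n) k))\<^sup>2 \<le> 2 / real m * (\<Sum>k\<in>?H. (real_of_int k)\<^sup>2 * (cmod (c (r n) k))\<^sup>2)"
        using m by (intro high_modes_small) auto
      also have "\<dots> \<le> 2 / real m * (\<Sum>k\<in>{- int (r n)..int (r n)}. (real_of_int k)\<^sup>2 * (cmod (c (r n) k))\<^sup>2)"
        by (intro mult_left_mono sum_mono2) auto
      also have "\<dots> \<le> 2 / real m * M" by (intro mult_left_mono M) simp
      also note mM
      finally have "(\<Sum>k\<in>?H. cmod (c (r n) k)) < e / 4"
        using e by (intro power2_less_imp_less[of _ "e / 4"]) auto
      then have "cmod (trig_sum ?H (c (r n)) x) < e / 4"
        using norm_trig_sum_le le_less_trans by blast
      moreover have "cmod (trig_sum ?L (a (r n)) x - trig_sum ?L l x) < e / 4"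
        using N[of n x] n by (simp add: dist_norm)
      ultimately have "cmod ((trig_sum ?L (a (r n)) x - trig_sum ?L l x) + trig_sum ?H (c (r n)) x) < e / 2"
        by (intro le_less_trans[OF norm_triangle_ineq]) linarith
      then show ?thesis by (simp add: dist_norm split algebra_simps)
    qed
    show "\<exists>N. \<forall>x\<in>UNIV. \<forall>i\<ge>N. \<forall>n\<ge>N. dist (v i x) (v n x) < e"
    proof (intro exI[of _ "max N m"] ballI allI impI)
      fix x i n assume "max N m \<le> i" "max N m \<le> n"
      then show "dist (v i x) (v n x) < e"
        by (rule dist_triangle_half_l[OF close close])
    qed
  qed
  then obtain u where "uniform_limit UNIV v u sequentially"
    using Cauchy_uniformly_convergent unfolding uniformly_convergent_on_def by blast
  with r show thesis using that unfolding v_def by blast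
qed

lemma bounded_range_uniform_limit:
  fixes v :: "nat \<Rightarrow> 'a \<Rightarrow> 'b::real_normed_vector"
  assumes lim: "uniform_limit UNIV v u sequentially" and b: "\<And>n. bounded (range (v n))"
  shows "bounded (range u)"
proof -
  obtain N where N: "\<And>x. dist (v N x) (u x) < 1"
    using lim unfolding uniform_limit_sequentially_iff by (metis UNIV_I order_refl zero_less_one)
  obtain B where B: "\<And>x. norm (v N x) \<le> B" using b[of N] unfolding bounded_iff by auto
  have "norm (u x) \<le> B + 1" for x
    using N[of x] B[of x] norm_triangle_ineq2[of "u x" "v N x"] by (simp add: dist_norm norm_minus_commute)
  then show ?thesis unfolding bounded_iff by blast
qed

text \<open>
  A fixed mode \<open>k\<close> belongs to all but finitely many of the truncated systems, and every term of its equation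
  is continuous under uniform convergence.  So no convergence of derivatives is required.
\<close>

lemma fourier_solution_exists:
  fixes d \<zeta> \<omega> :: real
  assumes d: "d \<noteq> 0" and f: "f absolutely_integrable_on {0..2 * pi}"
    and f2: "(\<lambda>x. (cmod (f x))\<^sup>2) integrable_on {0..2 * pi}"
  obtains u where "continuous_on UNIV u" "\<And>x. u (x + 2 * pi) = u x"
    "\<And>k. (of_real (d * (real_of_int k)\<^sup>2 - \<omega> * of_int k + \<zeta>) - \<i>) * fourier_coeff u k =
             fourier_coeff (\<lambda>x. cubic (u x)) k - \<i> * fourier_coeff f k"
proof -
  define A where "A = integral {0..2 * pi} (\<lambda>x. (cmod (f x))\<^sup>2) / (2 * pi)"
  have A: "0 \<le> A"
    unfolding A_def by (intro divide_nonneg_nonneg Henstock_Kurzweil_Integration.integral_nonneg f2) auto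
  define l where "l k = of_real (d * (real_of_int k)\<^sup>2 - \<omega> * of_int k + \<zeta>) - \<i>" for k
  define I where "I n = {- int n..int n}" for n
  have "\<exists>c. (\<Sum>k\<in>I n. (cmod (c k))\<^sup>2) \<le> A + 1 \<and> (\<forall>k\<in>I n.
          l k * c k = fourier_coeff (\<lambda>x. cubic (trig_sum (I n) c x)) k - \<i> * fourier_coeff f k)" for n
    by (rule galerkin_solution[OF _ f f2, of "I n" l]) (auto simp: I_def l_def A_def)
  then obtain c where c1: "\<And>n. (\<Sum>k\<in>I n. (cmod (c n k))\<^sup>2) \<le> A + 1"
    and c2: "\<And>n k. k \<in> I n \<Longrightarrow>
          l k * c n k = fourier_coeff (\<lambda>x. cubic (trig_sum (I n) (c n) x)) k - \<i> * fourier_coeff f k"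
    by metis
  have "0 \<le> A + 1" using A by simp
  from galerkin_derivative_bound[OF d this, where A = A and \<omega> = \<omega> and \<zeta> = \<zeta>]
  obtain M where M: "\<And>K c f. finite K \<Longrightarrow> f absolutely_integrable_on {0..2 * pi} \<Longrightarrow>
       (\<lambda>x. (cmod (f x))\<^sup>2) integrable_on {0..2 * pi} \<Longrightarrow>
       integral {0..2 * pi} (\<lambda>x. (cmod (f x))\<^sup>2) / (2 * pi) \<le> A \<Longrightarrow>
       (\<Sum>k\<in>K. (cmod (c k))\<^sup>2) \<le> A + 1 \<Longrightarrow>
       (\<And>k. k \<in> K \<Longrightarrow> l k * c k =
             fourier_coeff (\<lambda>x. cubic (trig_sum K c x)) k - \<i> * fourier_coeff f k) \<Longrightarrow>
       (\<Sum>k\<in>K. (real_of_int k)\<^sup>2 * (cmod (c k))\<^sup>2) \<le> M"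
    unfolding l_def by blast
  have c3: "(\<Sum>k\<in>I n. (real_of_int k)\<^sup>2 * (cmod (c n k))\<^sup>2) \<le> M" for n
    by (rule M[OF _ f f2 _ c1 c2]) (auto simp: A_def I_def)
  obtain r u where r: "strict_mono r"
    and lim: "uniform_limit UNIV (\<lambda>n. trig_sum (I (r n)) (c (r n))) u sequentially"
    using bounded_modes_uniformly_convergent_subsequence[of c "A + 1" M] c1 c3 unfolding I_def by metis
  have cont: "continuous_on UNIV u"
    using uniform_limit_theorem[OF _ lim] by (simp add: continuous_trig_sum)
  have lim3: "uniform_limit UNIV (\<lambda>n x. cubic (trig_sum (I (r n)) (c (r n)) x)) (\<lambda>x. cubic (u x)) sequentially"
    by (intro uniform_limit_cubic lim bounded_range_uniform_limit[OF lim] bounded_trig_sum)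
  show thesis
  proof
    show "continuous_on UNIV u" by (rule cont)
    fix x
    have "(\<lambda>n. trig_sum (I (r n)) (c (r n)) x) \<longlonglongrightarrow> u x"
      "(\<lambda>n. trig_sum (I (r n)) (c (r n)) (x + 2 * pi)) \<longlonglongrightarrow> u (x + 2 * pi)"
      using lim by (auto intro: tendsto_uniform_limitI)
    then show "u (x + 2 * pi) = u x"
      unfolding trig_sum_period using LIMSEQ_unique by blast
  next
    fix k
    have "\<forall>\<^sub>F n in sequentially. k \<in> I (r n)"
      using eventually_ge_at_top[of "nat \<bar>k\<bar>"]
    proof eventually_elim
      case (elim n)
      then show ?case using seq_suble[OF r, of n] by (auto simp: I_def)
    qed
    then have ev: "\<forall>\<^sub>F n in sequentially. l k * fourier_coeff (trig_sum (I (r n)) (c (r n))) k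
        = fourier_coeff (\<lambda>x. cubic (trig_sum (I (r n)) (c (r n)) x)) k - \<i> * fourier_coeff f k"
    proof eventually_elim
      case (elim n)
      have "finite (I (r n))" by (simp add: I_def)
      with elim show ?case by (simp add: fourier_coeff_trig_sum c2)
    qed
    have "(\<lambda>n. l k * fourier_coeff (trig_sum (I (r n)) (c (r n))) k) \<longlonglongrightarrow> l k * fourier_coeff u k"
      by (intro tendsto_intros tendsto_fourier_coeff lim continuous_trig_sum)
    then have "(\<lambda>n. fourier_coeff (\<lambda>x. cubic (trig_sum (I (r n)) (c (r n)) x)) k - \<i> * fourier_coeff f k)
        \<longlonglongrightarrow> l k * fourier_coeff u k"
      using ev by (rule Lim_transform_eventually)
    moreover have "(\<lambda>n. fourier_coeff (\<lambda>x. cubic (trig_sum (I (r n)) (c (r n)) x)) k - \<i> * fourier_coeff f k)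
        \<longlonglongrightarrow> fourier_coeff (\<lambda>x. cubic (u x)) k - \<i> * fourier_coeff f k"
      by (intro tendsto_intros tendsto_fourier_coeff lim3 continuous_on_cubic continuous_trig_sum)
    ultimately show "(of_real (d * (real_of_int k)\<^sup>2 - \<omega> * of_int k + \<zeta>) - \<i>) * fourier_coeff u k =
             fourier_coeff (\<lambda>x. cubic (u x)) k - \<i> * fourier_coeff f k"
      unfolding l_def using LIMSEQ_unique by blast
  qed
qed

section \<open>Uniqueness of Fourier coefficients\<close>

lemma fourier_coeff_mult_cis:
  "fourier_coeff (\<lambda>x. w x * cis (of_int j * x)) k = fourier_coeff w (k - j)"
  unfolding fourier_coeff_def
  by (simp add: mult.assoc cis_mult left_diff_distrib add.commute)

lemma fourier_coeff_add:
  assumes "g absolutely_integrable_on {0..2 * pi}" "h absolutely_integrable_on {0..2 * pi}"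
  shows "fourier_coeff (\<lambda>x. g x + h x) k = fourier_coeff g k + fourier_coeff h k"
  unfolding fourier_coeff_def distrib_right
  by (subst Henstock_Kurzweil_Integration.integral_add)
     (auto intro!: integrable_mult_continuous assms continuous_intros simp: add_divide_distrib)

lemma continuous_on_real_polynomial_cis:
  assumes "real_polynomial_function p"
  shows "continuous_on S (\<lambda>x. complex_of_real (p (cis x)))"
proof -
  have "continuous_on (cis ` S) p"
    using continuous_real_polymonial_function[OF assms] continuous_at_imp_continuous_on by blast
  moreover have "continuous_on S cis" by (intro continuous_intros)
  ultimately show ?thesis
    by (intro continuous_on_of_real continuous_on_compose2[of "cis ` S" p S cis]) auto
qed

text \<open>
  The continuous functions with vanishing Fourier coefficients are stable under multiplication by
  \<open>cos\<close> and \<open>sin\<close>, since these shift the coefficients.  Formulating the induction for all such \<open>w\<close> at once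
  turns the product case into a composition, with no products of trigonometric sums to expand.
\<close>

lemma fourier_coeff_mult_polynomial_eq_0:
  assumes "real_polynomial_function p"
    and "continuous_on UNIV w" "\<And>k. fourier_coeff w k = 0"
  shows "fourier_coeff (\<lambda>x. w x * of_real (p (cis x))) k = 0"
  using assms
proof (induction p arbitrary: w k rule: real_polynomial_function.induct)
  case (linear p)
  then interpret p: bounded_linear p by simp
  define \<alpha> \<beta> where "\<alpha> = (of_real (p 1) - \<i> * of_real (p \<i>)) / 2" and "\<beta> = (of_real (p 1) + \<i> * of_real (p \<i>)) / 2"
  have "p (cis x) = cos x * p 1 + sin x * p \<i>" for x
  proof -
    have "cis x = cos x *\<^sub>R 1 + sin x *\<^sub>R \<i>" by (simp add: complex_eq_iff)
    then show ?thesis by (simp only: p.add p.scaleR real_scaleR_def)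
  qed
  then have *: "w x * of_real (p (cis x)) = \<alpha> * (w x * cis (of_int 1 * x)) + \<beta> * (w x * cis (of_int (- 1) * x))" for x
    by (simp add: \<alpha>_def \<beta>_def complex_eq_iff field_simps)
  show ?case
    unfolding * using linear.prems
    by (subst fourier_coeff_add)
       (auto intro!: continuous_absolutely_integrable continuous_intros
             simp: fourier_coeff_mult fourier_coeff_mult_cis[of _ 1] fourier_coeff_mult_cis[of _ "- 1"]
             simp del: of_int_1 of_int_minus)
next
  case (const c)
  then show ?case using fourier_coeff_mult[of "of_real c" w k] by (simp add: mult.commute)
next
  case (add p q)
  show ?case
    unfolding of_real_add distrib_left using add
    by (subst fourier_coeff_add)
       (auto intro!: continuous_absolutely_integrable continuous_on_mult continuous_on_real_polynomial_cis)
next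
  case (mult p q)
  have "fourier_coeff (\<lambda>x. (w x * of_real (p (cis x))) * of_real (q (cis x))) k = 0"
    using mult by (intro mult.IH) (auto intro!: continuous_on_mult continuous_on_real_polynomial_cis)
  then show ?case by (simp add: mult.assoc)
qed

lemma periodic_eq_if_cis_eq:
  assumes "\<And>x. g (x + 2 * pi) = g x" "cis x = cis y"
  shows "g x = (g y :: 'a)"
proof -
  interpret periodic_fun_simple g "2 * pi" by unfold_locales (rule assms)
  have "sin x = sin y \<and> cos x = cos y"
    using assms(2) by (auto simp: complex_eq_iff)
  then obtain n :: int where "x = y + 2 * pi * of_int n" unfolding sin_cos_eq_iff by blast
  then show ?thesis using plus_of_int[of y n] by (simp add: mult_ac)
qed

text \<open>
  A continuous periodic function descends to the circle.  \<open>Arg\<close> jumps on the negative real axis, where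
  \<open>Arg2pi\<close> is used instead; by periodicity the two branches give the same function.
\<close>

lemma continuous_on_circle_of_periodic:
  fixes g :: "real \<Rightarrow> real"
  assumes cont: "continuous_on UNIV g" and per: "\<And>x. g (x + 2 * pi) = g x"
  shows "continuous_on (sphere 0 1) (\<lambda>z. g (Arg z))"
proof (intro continuous_at_imp_continuous_on ballI)
  fix z :: complex assume "z \<in> sphere 0 1"
  then have z: "z \<noteq> 0" by auto
  have g: "isCont g x" for x using cont by (simp add: continuous_on_eq_continuous_at)
  show "isCont (\<lambda>z. g (Arg z)) z"
  proof (cases "z \<in> \<real>\<^sub>\<le>\<^sub>0")
    case False
    then show ?thesis by (intro isCont_o2[OF continuous_at_Arg g])
  next
    case True
    with z have "z \<notin> \<real>\<^sub>\<ge>\<^sub>0"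
      by (auto simp: complex_nonpos_Reals_iff complex_nonneg_Reals_iff complex_eq_iff)
    then have "isCont (\<lambda>z. g (Arg2pi z)) z"
      by (intro isCont_o2[OF continuous_at_Arg2pi g])
    moreover have "g (Arg2pi y) = g (Arg y)" if "y \<noteq> 0" for y
    proof (rule periodic_eq_if_cis_eq[of g, OF per])
      have "of_real (cmod y) * cis (Arg2pi y) = of_real (cmod y) * cis (Arg y)"
        using Arg2pi_eq[of y] Arg_eq[OF that] by (simp add: cis_conv_exp)
      then show "cis (Arg2pi y) = cis (Arg y)" using that by simp
    qed
    moreover have "\<forall>\<^sub>F y in nhds z. y \<noteq> 0"
      using z by (intro t1_space_nhds) 
    ultimately show ?thesis
      by (subst isCont_cong[of _ "\<lambda>z. g (Arg2pi z)"]) (auto elim: eventually_mono)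
  qed
qed

text \<open>
  By the Stone-Weierstrass theorem on the circle, \<open>g\<close> is a uniform limit of functions \<open>p (cis x)\<close> with
  polynomial \<open>p\<close>, and the integral of \<open>w\<close> against each of these vanishes.
\<close>

lemma integral_mult_real_eq_0:
  fixes g :: "real \<Rightarrow> real"
  assumes w: "continuous_on UNIV w" "\<And>k. fourier_coeff w k = 0"
    and g: "continuous_on UNIV g" "\<And>x. g (x + 2 * pi) = g x"
  shows "integral {0..2 * pi} (\<lambda>x. w x * of_real (g x)) = 0"
proof -
  have "bounded (w ` {0..2 * pi})"
    by (intro compact_imp_bounded compact_continuous_image continuous_on_subset[OF w(1)]) auto
  then obtain B where B: "B > 0" "\<And>x. x \<in> {0..2 * pi} \<Longrightarrow> cmod (w x) \<le> B"
    unfolding bounded_pos by auto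
  have "cmod (integral {0..2 * pi} (\<lambda>x. w x * of_real (g x))) \<le> e" if e: "e > 0" for e
  proof -
    define e' where "e' = e / (2 * pi * B)"
    have "e' > 0" using e B by (simp add: e'_def)
    then obtain p where p: "real_polynomial_function p"
      and close: "\<And>z. z \<in> sphere 0 1 \<Longrightarrow> \<bar>g (Arg z) - p z\<bar> < e'"
      using Stone_Weierstrass_real_polynomial_function[OF compact_sphere
          continuous_on_circle_of_periodic[OF g]] by metis
    have gp: "\<bar>g x - p (cis x)\<bar> < e'" for x
    proof -
      have "g (Arg (cis x)) = g x"
        by (rule periodic_eq_if_cis_eq[of g, OF g(2)]) (metis cis_Arg cis_neq_zero norm_cis sgn_cis)
      then show ?thesis using close[of "cis x"] by simp
    qed
    have "integral {0..2 * pi} (\<lambda>x. w x * of_real (p (cis x))) = 0"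
      using fourier_coeff_mult_polynomial_eq_0[OF p w, of 0] by (simp add: fourier_coeff_def)
    then have "integral {0..2 * pi} (\<lambda>x. w x * of_real (g x))
        = integral {0..2 * pi} (\<lambda>x. w x * of_real (g x) - w x * of_real (p (cis x)))"
      by (subst Henstock_Kurzweil_Integration.integral_diff)
         (auto intro!: integrable_continuous_interval continuous_intros continuous_on_real_polynomial_cis p
            continuous_on_subset[OF w(1)] continuous_on_subset[OF g(1)])
    also have "cmod \<dots> \<le> (B * e') * (2 * pi - 0)"
    proof (rule integral_bound)
      show "continuous_on {0..2 * pi} (\<lambda>x. w x * of_real (g x) - w x * of_real (p (cis x)))"
        by (intro continuous_intros continuous_on_real_polynomial_cis p
            continuous_on_subset[OF w(1)] continuous_on_subset[OF g(1)]) auto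
      fix x assume "x \<in> {0..2 * pi}"
      then have "cmod (w x) * \<bar>g x - p (cis x)\<bar> \<le> B * e'"
        using B gp[of x] by (intro mult_mono) auto
      then show "cmod (w x * of_real (g x) - w x * of_real (p (cis x))) \<le> B * e'"
        by (simp add: norm_mult flip: right_diff_distrib of_real_diff)
    qed simp
    also have "\<dots> = e" using B by (simp add: e'_def)
    finally show ?thesis .
  qed
  then have "cmod (integral {0..2 * pi} (\<lambda>x. w x * of_real (g x))) \<le> 0"
    by (rule field_le_epsilon[of _ 0, simplified])
  then show ?thesis by simp
qed

text \<open>
  Such a function is orthogonal to its own real and imaginary parts, hence has \<open>L\<^sup>2\<close> norm zero.
\<close>

lemma continuous_periodic_fourier_coeff_eq_0:
  assumes cont: "continuous_on UNIV w" and per: "\<And>x. w (x + 2 * pi) = w x"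
    and "\<And>k. fourier_coeff w k = 0"
  shows "w x = 0"
proof -
  have "integral {0..2 * pi} (\<lambda>x. w x * of_real (Re (w x))) = 0"
    "integral {0..2 * pi} (\<lambda>x. w x * of_real (Im (w x))) = 0"
    using assms by (auto intro!: integral_mult_real_eq_0 continuous_intros)
  then have "integral {0..2 * pi} (\<lambda>x. w x * of_real (Re (w x)) - \<i> * (w x * of_real (Im (w x)))) = 0"
    by (subst Henstock_Kurzweil_Integration.integral_diff)
       (auto intro!: integrable_continuous_interval continuous_intros continuous_on_subset[OF cont])
  moreover have "w x * of_real (Re (w x)) - \<i> * (w x * of_real (Im (w x))) = complex_of_real ((cmod (w x))\<^sup>2)" for x
    unfolding complex_norm_square by (simp add: complex_eq_iff algebra_simps)
  moreover have cont2: "continuous_on {0..2 * pi} (\<lambda>x. (cmod (w x))\<^sup>2)"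
    by (intro continuous_intros continuous_on_subset[OF cont]) auto
  ultimately have "complex_of_real (integral {0..2 * pi} (\<lambda>x. (cmod (w x))\<^sup>2)) = 0"
    by (simp only: integral_of_real_complex[OF integrable_continuous_interval[OF cont2]])
  then have "integral {0..2 * pi} (\<lambda>x. (cmod (w x))\<^sup>2) = 0" by simp
  then have 0: "w y = 0" if "y \<in> {0..2 * pi}" for y
    using integral_eq_0_iff[OF cont2] that by auto
  have "cis x = cis (Arg2pi (cis x))"
    using Arg2pi_eq[of "cis x"] by (simp add: cis_conv_exp)
  then have "w x = w (Arg2pi (cis x))" by (rule periodic_eq_if_cis_eq[of w, OF per])
  also have "\<dots> = 0" using Arg2pi[of "cis x"] by (intro 0) auto
  finally show ?thesis .
qed

section \<open>Indefinite integrals of locally integrable functions\<close>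

text \<open>
  Partial integration when \<open>h\<close> is only integrable, so that \<open>H\<close> need not be differentiable
  everywhere.  The defect \<open>\<Psi> x\<close> of the formula on \<open>[a, x]\<close> satisfies
  \<open>|\<Psi> y - \<Psi> x| \<le> 2 B |y - x| |N y - N x|\<close>, where \<open>N\<close> is the indefinite integral of \<open>|h|\<close> and \<open>B\<close> bounds \<open>\<phi>'\<close>.  As \<open>N\<close>
  is continuous, \<open>\<Psi>\<close> has derivative zero everywhere and is constant.
\<close>

lemma integration_by_parts_indefinite_integral:
  fixes h H \<phi> \<phi>' :: "real \<Rightarrow> complex"
  assumes h: "h absolutely_integrable_on {a..b}"
    and H: "\<And>x y. a \<le> x \<Longrightarrow> x \<le> y \<Longrightarrow> y \<le> b \<Longrightarrow> H y - H x = integral {x..y} h"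
    and \<phi>: "\<And>x. x \<in> {a..b} \<Longrightarrow> (\<phi> has_vector_derivative \<phi>' x) (at x within {a..b})"
    and \<phi>': "continuous_on {a..b} \<phi>'" and ab: "a \<le> b"
  shows "integral {a..b} (\<lambda>x. H x * \<phi>' x) = H b * \<phi> b - H a * \<phi> a - integral {a..b} (\<lambda>x. h x * \<phi> x)"
proof -
  have hi: "h integrable_on {a..b}" and nhi: "(\<lambda>x. cmod (h x)) integrable_on {a..b}"
    using h by (auto simp: absolutely_integrable_on_def)
  have cH: "continuous_on {a..b} H"
  proof -
    have "continuous_on {a..b} (\<lambda>x. H a + integral {a..x} h)"
      by (intro continuous_intros indefinite_integral_continuous_1 hi)
    moreover have "H a + integral {a..x} h = H x" if "x \<in> {a..b}" for x
      using H[of a x] that by (simp add: algebra_simps)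
    ultimately show ?thesis by (rule continuous_on_eq)
  qed
  have c\<phi>: "continuous_on {a..b} \<phi>"
    using \<phi> by (intro continuous_on_vector_derivative)
  have i1: "(\<lambda>x. h x * \<phi> x) integrable_on {a..b}" by (rule integrable_mult_continuous[OF h c\<phi>])
  have i2: "(\<lambda>x. H x * \<phi>' x) integrable_on {a..b}"
    by (intro integrable_continuous_interval continuous_on_mult cH \<phi>')
  obtain B where B: "B > 0" "\<And>x. x \<in> {a..b} \<Longrightarrow> cmod (\<phi>' x) \<le> B"
    using compact_imp_bounded[OF compact_continuous_image[OF \<phi>' compact_Icc]] unfolding bounded_pos by auto
  define N where "N x = integral {a..x} (\<lambda>t. cmod (h t))" for x
  have cN: "continuous_on {a..b} N"
    unfolding N_def by (rule indefinite_integral_continuous_1[OF nhi])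
  have Nd: "N y - N x = integral {x..y} (\<lambda>t. cmod (h t))" if "a \<le> x" "x \<le> y" "y \<le> b" for x y
    unfolding N_def using that
    by (subst Henstock_Kurzweil_Integration.integral_combine[of a x y, symmetric])
       (auto intro: integrable_subinterval_real[OF nhi])
  define \<Psi> where "\<Psi> x = H x * \<phi> x - integral {a..x} (\<lambda>t. h t * \<phi> t) - integral {a..x} (\<lambda>t. H t * \<phi>' t)" for x
  have est: "cmod (\<Psi> y - \<Psi> x) \<le> 2 * B * (y - x) * (N y - N x)" if xy: "a \<le> x" "x \<le> y" "y \<le> b" for x y
  proof -
    have sub: "g integrable_on {x..y}" if "g integrable_on {a..b}" for g :: "real \<Rightarrow> complex"
      using integrable_subinterval_real[OF that, of x y] xy by auto
    have nsub: "(\<lambda>x. cmod (h x)) integrable_on {x..y}"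
      using integrable_subinterval_real[OF nhi, of x y] xy by auto
    have comb: "integral {a..y} g - integral {a..x} g = integral {x..y} g" if "g integrable_on {a..b}" for g :: "real \<Rightarrow> complex"
      using xy integrable_subinterval_real[OF that, of a y]
      by (subst Henstock_Kurzweil_Integration.integral_combine[of a x y, symmetric]) auto
    have ftc: "\<phi> y - \<phi> t = integral {t..y} \<phi>'" if "x \<le> t" "t \<le> y" for t
    proof -
      have "(\<phi>' has_integral (\<phi> y - \<phi> t)) {t..y}"
        using xy that by (intro fundamental_theorem_of_calculus has_vector_derivative_within_subset[OF \<phi>]) auto
      then show ?thesis by (simp add: integral_unique)
    qed
    have I1: "(\<lambda>t. h t * (\<phi> y - \<phi> t)) integrable_on {x..y}"
      unfolding right_diff_distrib
      by (intro Henstock_Kurzweil_Integration.integrable_diff sub i1 integrable_on_mult_left hi)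
    have I2: "(\<lambda>t. (H x - H t) * \<phi>' t) integrable_on {x..y}"
      using xy unfolding left_diff_distrib
      by (intro Henstock_Kurzweil_Integration.integrable_diff sub i2 integrable_on_mult_right
            integrable_continuous_interval \<phi>')
    have J1: "integral {x..y} (\<lambda>t. h t * (\<phi> y - \<phi> t)) = (H y - H x) * \<phi> y - integral {x..y} (\<lambda>t. h t * \<phi> t)"
      unfolding right_diff_distrib H[OF xy]
      by (subst Henstock_Kurzweil_Integration.integral_diff)
         (auto intro!: sub i1 integrable_on_mult_left hi)
    have J2: "integral {x..y} (\<lambda>t. (H x - H t) * \<phi>' t) = H x * (\<phi> y - \<phi> x) - integral {x..y} (\<lambda>t. H t * \<phi>' t)"
      unfolding left_diff_distrib ftc[OF order_refl xy(2)]
      by (subst Henstock_Kurzweil_Integration.integral_diff)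
         (auto intro!: sub i2 integrable_on_mult_right integrable_continuous_interval[OF \<phi>'])
    have "\<Psi> y - \<Psi> x = integral {x..y} (\<lambda>t. h t * (\<phi> y - \<phi> t)) + integral {x..y} (\<lambda>t. (H x - H t) * \<phi>' t)"
      unfolding \<Psi>_def J1 J2 comb[OF i1, symmetric] comb[OF i2, symmetric] by (simp add: algebra_simps)
    also have "cmod \<dots> \<le> cmod (integral {x..y} (\<lambda>t. h t * (\<phi> y - \<phi> t))) + cmod (integral {x..y} (\<lambda>t. (H x - H t) * \<phi>' t))"
      by (rule norm_triangle_ineq)
    also have "cmod (integral {x..y} (\<lambda>t. h t * (\<phi> y - \<phi> t))) \<le> integral {x..y} (\<lambda>t. cmod (h t) * (B * (y - x)))"
    proof (rule integral_norm_bound_integral[OF I1])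
      show "(\<lambda>t. cmod (h t) * (B * (y - x))) integrable_on {x..y}"
        by (intro integrable_on_mult_left nsub)
      fix t assume t: "t \<in> {x..y}"
      have "cmod (\<phi> y - \<phi> t) \<le> B * (y - t)"
        using t xy B(2) ftc[of t]
        by (auto intro!: integral_bound continuous_on_subset[OF \<phi>'])
      also have "\<dots> \<le> B * (y - x)" using t B by (intro mult_left_mono) auto
      finally show "cmod (h t * (\<phi> y - \<phi> t)) \<le> cmod (h t) * (B * (y - x))"
        by (simp add: norm_mult mult_left_mono)
    qed
    also have "\<dots> = (N y - N x) * (B * (y - x))"
      by (simp add: Nd[OF xy])
    also have "cmod (integral {x..y} (\<lambda>t. (H x - H t) * \<phi>' t)) \<le> integral {x..y} (\<lambda>t. (N y - N x) * B)"
    proof (rule integral_norm_bound_integral[OF I2])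
      fix t assume t: "t \<in> {x..y}"
      have "H t - H x = integral {x..t} h" using t xy by (intro H) auto
      then have "cmod (H x - H t) \<le> integral {x..t} (\<lambda>t. cmod (h t))"
        using t xy by (auto simp: norm_minus_commute[of "H x"] intro!: integral_norm_bound_integral
            intro: integrable_subinterval_real[OF hi] integrable_subinterval_real[OF nhi])
      also have "\<dots> \<le> N y - N x"
        unfolding Nd[OF xy] using t xy
        by (intro integral_subset_le integrable_subinterval_real[OF nhi]) auto
      finally show "cmod ((H x - H t) * \<phi>' t) \<le> (N y - N x) * B"
        using B t xy by (auto simp: norm_mult intro!: mult_mono elim: order_trans[OF norm_ge_zero])
    qed (intro integrable_continuous_interval continuous_intros)
    also have "\<dots> = (N y - N x) * (B * (y - x))" using xy by simp
    finally show ?thesis by (simp add: algebra_simps)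
  qed
  have "(\<Psi> has_vector_derivative 0) (at x within {a..b})" if x: "x \<in> {a..b}" for x
    unfolding has_vector_derivative_def has_derivative_within
  proof (intro conjI)
    have bnd: "norm ((1 / norm (y - x)) *\<^sub>R (\<Psi> y - (\<Psi> x + (y - x) *\<^sub>R 0))) \<le> 2 * B * \<bar>N y - N x\<bar>"
      if y: "y \<in> {a..b}" "y \<noteq> x" for y
    proof -
      have "cmod (\<Psi> y - \<Psi> x) \<le> 2 * B * \<bar>y - x\<bar> * \<bar>N y - N x\<bar>"
      proof (cases "x \<le> y")
        case True
        have "cmod (\<Psi> y - \<Psi> x) \<le> 2 * B * (y - x) * (N y - N x)" using est[of x y] x y True by auto
        also have "\<dots> \<le> 2 * B * \<bar>y - x\<bar> * \<bar>N y - N x\<bar>" using True B by (auto intro!: mult_left_mono)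
        finally show ?thesis .
      next
        case False
        have "cmod (\<Psi> y - \<Psi> x) \<le> 2 * B * (x - y) * (N x - N y)"
          using est[of y x] x y False by (auto simp: norm_minus_commute)
        also have "\<dots> \<le> 2 * B * (x - y) * \<bar>N y - N x\<bar>" using False B by (intro mult_left_mono) auto
        also have "x - y = \<bar>y - x\<bar>" using False by simp
        finally show ?thesis .
      qed
      then show ?thesis using y by (simp add: divide_simps mult_ac)
    qed
    show "((\<lambda>y. (1 / norm (y - x)) *\<^sub>R (\<Psi> y - (\<Psi> x + (y - x) *\<^sub>R 0))) \<longlongrightarrow> 0) (at x within {a..b})"
    proof (rule Lim_null_comparison)
      show "\<forall>\<^sub>F y in at x within {a..b}.
          norm ((1 / norm (y - x)) *\<^sub>R (\<Psi> y - (\<Psi> x + (y - x) *\<^sub>R 0))) \<le> 2 * B * \<bar>N y - N x\<bar>"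
        using bnd by (auto simp: eventually_at_filter)
      have "(N \<longlongrightarrow> N x) (at x within {a..b})" using cN x by (simp add: continuous_on_def)
      then have "((\<lambda>y. 2 * B * \<bar>N y - N x\<bar>) \<longlongrightarrow> 2 * B * \<bar>N x - N x\<bar>) (at x within {a..b})"
        by (intro tendsto_intros)
      then show "((\<lambda>y. 2 * B * \<bar>N y - N x\<bar>) \<longlongrightarrow> 0) (at x within {a..b})" by simp
    qed
  qed (auto intro: bounded_linear_intros)
  then obtain c where "\<And>x. x \<in> {a..b} \<Longrightarrow> \<Psi> x = c"
    using has_vector_derivative_zero_constant[of "{a..b}" \<Psi>] by auto
  then have "\<Psi> b = \<Psi> a" using ab by simp
  then show ?thesis unfolding \<Psi>_def by (simp add: algebra_simps)
qed

lemma periodic_integrable_on: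
  fixes g :: "real \<Rightarrow> 'a::banach"
  assumes per: "\<And>x. g (x + T) = g x" and T: "T > 0" and g: "g integrable_on {0..T}"
  shows "g integrable_on {a..b}"
proof -
  interpret periodic_fun_simple g T by unfold_locales (rule per)
  have shift: "g integrable_on {of_int n * T..of_int n * T + T}" for n :: int
  proof -
    have "g \<circ> (+) (of_int n * T) = g" using plus_of_int[of _ n] by (auto simp: add.commute)
    then show ?thesis using g integrable_on_shift_Icc_real[of g "of_int n * T" 0 T] by (simp add: add.commute)
  qed
  have big: "g integrable_on {- (real m * T)..real m * T}" for m
  proof (induction m)
    case (Suc m)
    define s where "s = real m * T"
    have s: "0 \<le> s" "real (Suc m) * T = s + T" using T by (auto simp: s_def algebra_simps)
    have "g integrable_on {- (s + T)..- s}"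
      using shift[of "- int (Suc m)"] by (simp add: s_def algebra_simps)
    moreover have "g integrable_on {s..s + T}"
      using shift[of "int m"] by (simp add: s_def)
    moreover have "g integrable_on {- s..s}" using Suc by (simp add: s_def)
    ultimately have "g integrable_on {- (s + T)..s + T}"
      using s(1) T
      by (intro Henstock_Kurzweil_Integration.integrable_combine[of "- (s + T)" s "s + T"]
            Henstock_Kurzweil_Integration.integrable_combine[of "- (s + T)" "- s" s]) auto
    then show ?case unfolding s(2) .
  qed (use integrable_on_refl[of g 0] in simp)
  obtain m :: nat where "max \<bar>a\<bar> \<bar>b\<bar> / T < real m" using reals_Archimedean2 by blast
  then have "max \<bar>a\<bar> \<bar>b\<bar> < real m * T" using T by (simp add: field_simps)
  then show ?thesis by (intro integrable_subinterval_real[OF big[of m]]) auto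
qed

lemma periodic_absolutely_integrable_on:
  fixes g :: "real \<Rightarrow> complex"
  assumes "\<And>x. g (x + T) = g x" "T > 0" "g absolutely_integrable_on {0..T}"
  shows "g absolutely_integrable_on {a..b}"
  using assms periodic_integrable_on[of g T a b] periodic_integrable_on[of "\<lambda>x. norm (g x)" T a b]
  by (simp add: absolutely_integrable_on_def)

text \<open>
  Integrals over intervals with reversed end points are zero, so one of the two terms always vanishes and the
  difference is the oriented integral from \<open>0\<close> to \<open>x\<close>.
\<close>

definition primitive :: "(real \<Rightarrow> complex) \<Rightarrow> real \<Rightarrow> complex" where
  "primitive h x = integral {0..x} h - integral {x..0} h"

lemma primitive_diff:
  assumes h: "\<And>a b. h integrable_on {a..b}" and "a \<le> b"
  shows "primitive h b - primitive h a = integral {a..b} h"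
proof -
  note comb = Henstock_Kurzweil_Integration.integral_combine[OF _ _ h]
  have z: "integral {x..y} h = 0" if "y \<le> x" for x y
    using that by (cases "x = y") auto
  consider "0 \<le> a" | "a \<le> 0" "0 \<le> b" | "b \<le> 0" by linarith
  then show ?thesis
  proof cases
    case 1 then show ?thesis using comb[of 0 a b] \<open>a \<le> b\<close> by (simp add: primitive_def z algebra_simps)
  next
    case 2 then show ?thesis using comb[of a 0 b] by (simp add: primitive_def z algebra_simps)
  next
    case 3 then show ?thesis using comb[of a b 0] \<open>a \<le> b\<close> by (simp add: primitive_def z algebra_simps)
  qed
qed

lemma continuous_on_UNIV_if_Icc:
  fixes g :: "real \<Rightarrow> 'a::topological_space"
  assumes "\<And>a b. continuous_on {a..b} g"
  shows "continuous_on UNIV g"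
  unfolding continuous_on_eq_continuous_at[OF open_UNIV]
proof
  fix x
  have "continuous_on {x - 1<..<x + 1} g" by (rule continuous_on_subset[OF assms[of "x - 1" "x + 1"]]) auto
  then show "isCont g x" by (simp add: continuous_on_eq_continuous_at)
qed

lemma continuous_indefinite_integral:
  fixes h H :: "real \<Rightarrow> complex"
  assumes h: "\<And>a b. h integrable_on {a..b}" and H: "\<And>a b. a \<le> b \<Longrightarrow> H b - H a = integral {a..b} h"
  shows "continuous_on UNIV H"
proof (rule continuous_on_UNIV_if_Icc)
  fix a b
  have "continuous_on {a..b} (\<lambda>x. H a + integral {a..x} h)"
    by (intro continuous_intros indefinite_integral_continuous_1 h)
  moreover have "H a + integral {a..x} h = H x" if "x \<in> {a..b}" for x
    using H[of a x] that by (simp add: algebra_simps)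
  ultimately show "continuous_on {a..b} H" by (rule continuous_on_eq)
qed

text \<open>
  The increment of the primitive over one period does not depend on the starting point, and it vanishes at \<open>0\<close>.
\<close>

lemma primitive_periodic:
  assumes h: "\<And>a b. h integrable_on {a..b}" and per: "\<And>x. h (x + T) = h x" and T: "T \<ge> 0"
    and mean: "integral {0..T} h = 0"
  shows "primitive h (x + T) = primitive h x"
proof -
  have "h \<circ> (+) T = h" using per by (auto simp: add.commute)
  then have shift: "integral {a + T..b + T} h = integral {a..b} h" for a b
    using integral_shift_Icc_real[of a b h T] by simp
  have T0: "primitive h T = primitive h 0"
    using primitive_diff[OF h T] mean by simp
  have "primitive h (x + T) - primitive h T = primitive h x - primitive h 0"
  proof (cases "0 \<le> x")
    case True
    then show ?thesis using primitive_diff[OF h True] primitive_diff[OF h, of T "x + T"] shift[of 0 x] by simp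
  next
    case False
    then show ?thesis using primitive_diff[OF h, of x 0] primitive_diff[OF h, of "x + T" T] shift[of x 0]
      by (simp add: algebra_simps)
  qed
  with T0 show ?thesis by simp
qed

text \<open>
  Partial integration against a character; periodicity cancels the boundary terms.
\<close>

lemma fourier_coeff_indefinite_integral:
  assumes h: "h absolutely_integrable_on {0..2 * pi}"
    and H: "\<And>a b. a \<le> b \<Longrightarrow> H b - H a = integral {a..b} h" and per: "H (2 * pi) = H 0"
  shows "\<i> * of_int k * fourier_coeff H k = fourier_coeff h k"
proof -
  have "integral {0..2 * pi} (\<lambda>x. H x * (\<i> * of_real (- of_int k) * cis (- of_int k * x)))
      = H (2 * pi) * cis (- of_int k * (2 * pi)) - H 0 * cis (- of_int k * 0)
        - integral {0..2 * pi} (\<lambda>x. h x * cis (- of_int k * x))"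
    by (intro integration_by_parts_indefinite_integral h H has_vector_derivative_cis continuous_intros) auto
  moreover have "cis (- of_int k * (2 * pi)) = 1"
    using cis_int_period[of "- k" 0] by simp
  moreover have "integral {0..2 * pi} (\<lambda>x. H x * (\<i> * of_real (- of_int k) * cis (- of_int k * x)))
     = - (\<i> * of_int k) * integral {0..2 * pi} (\<lambda>x. H x * cis (- (of_int k * x)))"
    by (subst integral_mult_right[symmetric]) (simp add: mult_ac)
  ultimately have "\<i> * of_int k * integral {0..2 * pi} (\<lambda>x. H x * cis (- (of_int k * x)))
      = integral {0..2 * pi} (\<lambda>x. h x * cis (- (of_int k * x)))"
    using per by simp
  then show ?thesis by (simp add: fourier_coeff_def)
qed

section \<open>From Fourier coefficients back to the differential equation\<close>

lemma fourier_coeff_const: "fourier_coeff (\<lambda>x. a) k = (if k = 0 then a else 0)"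
  using fourier_coeff_trig_sum[of "{0}" "\<lambda>_. a" k] by (simp add: trig_sum_def[abs_def])

lemma absolutely_integrable_cmul:
  fixes g :: "real \<Rightarrow> complex"
  shows "g absolutely_integrable_on S \<Longrightarrow> (\<lambda>x. a * g x) absolutely_integrable_on S"
  by (rule set_integrable_mult_right) simp

lemma integral_eq_fourier_coeff_0: "integral {0..2 * pi} g = 2 * pi * fourier_coeff g 0"
  by (simp add: fourier_coeff_def)

text \<open>
  The coefficient equations say that \<open>- d u'' + \<i> \<omega> u' = h\<close> holds mode by mode.  Integrating
  once, \<open>u'\<close> ought to be \<open>p = (\<i> \<omega> u - H - C) / d\<close> with a primitive \<open>H\<close> of \<open>h\<close>; integrating \<open>p\<close> gives a function \<open>U\<close>.
  The case \<open>k = 0\<close> of the hypothesis makes \<open>H\<close> periodic, the choice of \<open>C\<close> makes \<open>U\<close> periodic, and the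
  constant in \<open>U\<close> matches the mean of \<open>u\<close>.  Then \<open>U\<close> and \<open>u\<close> have equal Fourier coefficients, so \<open>U = u\<close>.
\<close>

lemma regularity_from_fourier_coeffs:
  fixes d \<omega> :: real
  assumes d: "d \<noteq> 0" and u: "continuous_on UNIV u" "\<And>x. u (x + 2 * pi) = u x"
    and h: "h absolutely_integrable_on {0..2 * pi}" "\<And>x. h (x + 2 * pi) = h x"
    and eq: "\<And>k. of_real (d * (real_of_int k)\<^sup>2 - \<omega> * of_int k) * fourier_coeff u k = fourier_coeff h k"
  obtains p where "continuous_on UNIV p"
    and "\<And>a b. a \<le> b \<Longrightarrow> u b - u a = integral {a..b} p"
    and "\<And>a b. a \<le> b \<Longrightarrow> p b - p a = integral {a..b} (\<lambda>x. (\<i> * of_real \<omega> * p x - h x) / of_real d)"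
proof -
  have hai: "h absolutely_integrable_on {a..b}" for a b
    by (rule periodic_absolutely_integrable_on[OF h(2) _ h(1)]) simp
  then have hi: "h integrable_on {a..b}" for a b by (simp add: absolutely_integrable_on_def)
  define H where "H = primitive h"
  have Hd: "H b - H a = integral {a..b} h" if "a \<le> b" for a b
    unfolding H_def by (rule primitive_diff[OF hi that])
  have cH: "continuous_on UNIV H" by (rule continuous_indefinite_integral[OF hi Hd])
  have "integral {0..2 * pi} h = 0"
    using eq[of 0] by (simp add: integral_eq_fourier_coeff_0)
  then have perH: "H (x + 2 * pi) = H x" for x
    unfolding H_def by (intro primitive_periodic hi h(2)) auto
  \<comment> \<open>The constant of integration that gives \<open>p\<close> mean zero.\<close>
  define C where "C = \<i> * of_real \<omega> * fourier_coeff u 0 - fourier_coeff H 0"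
  define p where "p x = (\<i> * of_real \<omega> * u x - H x - C) / of_real d" for x
  have cp: "continuous_on UNIV p"
    unfolding p_def using d by (intro continuous_intros u(1) cH) auto
  have ci: "g absolutely_integrable_on {0..2 * pi}" if "continuous_on UNIV g" for g :: "real \<Rightarrow> complex"
    by (rule continuous_absolutely_integrable[OF that])
  have fp: "fourier_coeff p k = (\<i> * of_real \<omega> * fourier_coeff u k - fourier_coeff H k - (if k = 0 then C else 0)) / of_real d" for k
  proof -
    have "p = (\<lambda>x. 1 / of_real d * ((\<i> * of_real \<omega> * u x - H x) - C))" by (auto simp: p_def)
    then have "fourier_coeff p k = 1 / of_real d * fourier_coeff (\<lambda>x. (\<i> * of_real \<omega> * u x - H x) - C) k"
      by (simp only: fourier_coeff_mult)
    also have "fourier_coeff (\<lambda>x. (\<i> * of_real \<omega> * u x - H x) - C) k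
        = fourier_coeff (\<lambda>x. \<i> * of_real \<omega> * u x - H x) k - fourier_coeff (\<lambda>x. C) k"
      by (intro fourier_coeff_diff ci continuous_intros u(1) cH)
    also have "fourier_coeff (\<lambda>x. \<i> * of_real \<omega> * u x - H x) k = fourier_coeff (\<lambda>x. \<i> * of_real \<omega> * u x) k - fourier_coeff H k"
      by (intro fourier_coeff_diff ci continuous_intros u(1) cH)
    finally show ?thesis by (simp add: fourier_coeff_mult fourier_coeff_const)
  qed
  have perp: "p (x + 2 * pi) = p x" for x by (simp add: p_def u(2) perH)
  have pi': "p integrable_on {a..b}" for a b
    by (intro integrable_continuous_interval continuous_on_subset[OF cp]) auto
  define U where "U x = primitive p x + (fourier_coeff u 0 - fourier_coeff (primitive p) 0)" for x
  have Ud: "U b - U a = integral {a..b} p" if "a \<le> b" for a b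
    using primitive_diff[OF pi' that] by (simp add: U_def)
  have "integral {0..2 * pi} p = 0"
    by (simp add: integral_eq_fourier_coeff_0 fp C_def)
  then have perU: "U (x + 2 * pi) = U x" for x
    unfolding U_def using primitive_periodic[OF pi' perp] by simp
  have cP: "continuous_on UNIV (primitive p)"
    by (rule continuous_indefinite_integral[OF pi' primitive_diff[OF pi']])
  have cU: "continuous_on UNIV U" unfolding U_def by (intro continuous_intros cP)
  have fU: "fourier_coeff U k = fourier_coeff u k" for k
  proof (cases "k = 0")
    case True
    have "fourier_coeff U k = fourier_coeff (primitive p) k + fourier_coeff (\<lambda>x. fourier_coeff u 0 - fourier_coeff (primitive p) 0) k"
      unfolding U_def by (intro fourier_coeff_add ci cP continuous_intros)
    then show ?thesis using True by (simp add: fourier_coeff_const)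
  next
    case False
    have "\<i> * of_int k * fourier_coeff H k = of_real (d * (real_of_int k)\<^sup>2 - \<omega> * of_int k) * fourier_coeff u k"
      unfolding eq using perH[of 0] by (intro fourier_coeff_indefinite_integral h Hd) auto
    also have "\<dots> = \<i> * of_int k * ((\<i> * of_real \<omega> - \<i> * of_real d * of_int k) * fourier_coeff u k)"
      by (simp add: algebra_simps power2_eq_square)
    finally have H: "fourier_coeff H k = (\<i> * of_real \<omega> - \<i> * of_real d * of_int k) * fourier_coeff u k"
      using False by simp
    have "\<i> * of_int k * fourier_coeff U k = fourier_coeff p k"
      using perU[of 0] by (intro fourier_coeff_indefinite_integral ci cp Ud) auto
    also have "\<dots> = \<i> * of_int k * fourier_coeff u k"
      using False d by (simp add: fp H field_simps)
    finally show ?thesis using False by simp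
  qed
  have "U x - u x = 0" for x
  proof (rule continuous_periodic_fourier_coeff_eq_0)
    show "continuous_on UNIV (\<lambda>x. U x - u x)" by (intro continuous_intros cU u(1))
    show "fourier_coeff (\<lambda>x. U x - u x) k = 0" for k
      by (simp add: fourier_coeff_diff ci cU u(1) fU)
  qed (simp add: perU u(2))
  then have "U = u" by auto
  show thesis
  proof
    show "continuous_on UNIV p" by (rule cp)
    show ud: "u b - u a = integral {a..b} p" if "a \<le> b" for a b
      using Ud[OF that] \<open>U = u\<close> by simp
    show "p b - p a = integral {a..b} (\<lambda>x. (\<i> * of_real \<omega> * p x - h x) / of_real d)" if ab: "a \<le> b" for a b
    proof -
      have "integral {a..b} (\<lambda>x. (\<i> * of_real \<omega> * p x - h x) / of_real d)
          = (\<i> * of_real \<omega> * integral {a..b} p - integral {a..b} h) / of_real d"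
        by (simp add: Henstock_Kurzweil_Integration.integral_diff integrable_on_mult_right pi' hi)
      also have "\<dots> = p b - p a"
        unfolding ud[OF ab, symmetric] Hd[OF ab, symmetric] p_def using d by (simp add: field_simps)
      finally show ?thesis by simp
    qed
  qed
qed


section \<open>Weak derivatives\<close>

lemma integrable_lebesgue_on_compact:
  fixes g :: "real \<Rightarrow> complex"
  assumes "\<And>a b. g absolutely_integrable_on {a..b}" "compact K"
  shows "integrable (lebesgue_on K) g"
proof -
  obtain a where "K \<subseteq> {- a..a}"
    using bounded_subset_cbox_symmetric[OF compact_imp_bounded[OF assms(2)]] by auto
  then have "set_integrable lebesgue K g"
    using assms by (intro set_integrable_subset[OF assms(1)]) (auto intro: lmeasurable_compact fmeasurableD)
  then show ?thesis
    using assms(2) unfolding set_integrable_def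
    by (subst integrable_restrict_space) (auto intro: lmeasurable_compact fmeasurableD)
qed

lemma locally_integrable_on_UNIV_I:
  assumes "\<And>a b. g absolutely_integrable_on {a..b}"
  shows "g locally_integrable_on UNIV"
  unfolding locally_integrable_on_def using integrable_lebesgue_on_compact[OF assms] by blast

lemma locally_square_integrable_on_UNIV_I:
  assumes g: "\<And>a b. g absolutely_integrable_on {a..b}"
    and g2: "\<And>a b. (\<lambda>x. (cmod (g x))\<^sup>2) integrable_on {a..b}"
  shows "g locally_square_integrable_on UNIV"
  unfolding locally_square_integrable_on_def square_integrable_on_def
proof safe
  fix K :: "real set" assume K: "compact K"
  show "g \<in> borel_measurable (lebesgue_on K)"
    using integrable_lebesgue_on_compact[OF g K] by (rule borel_measurable_integrable)
  have "(\<lambda>x. complex_of_real ((cmod (g x))\<^sup>2)) absolutely_integrable_on {a..b}" for a b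
    unfolding absolutely_integrable_on_def
    using has_integral_integrable[OF has_integral_of_real[OF integrable_integral[OF g2[of a b]]]] g2[of a b]
    by (simp add: norm_power)
  from integrable_norm[OF integrable_lebesgue_on_compact[OF this K]]
  show "integrable (lebesgue_on K) (\<lambda>x. (cmod (g x))\<^sup>2)" by (simp add: norm_power)
qed

lemma LINT_eq_integral_Icc:
  fixes F :: "real \<Rightarrow> complex"
  assumes F: "F absolutely_integrable_on {a..b}" and 0: "\<And>x. x \<notin> {a..b} \<Longrightarrow> F x = 0"
  shows "(LINT x|lebesgue_on UNIV. F x) = integral {a..b} F"
proof -
  have "(LINT x|lebesgue_on UNIV. F x) = (LINT x:{a..b}|lebesgue. F x)"
    unfolding set_lebesgue_integral_def lebesgue_on_UNIV_eq
    by (rule Bochner_Integration.integral_cong) (auto simp: 0 indicator_def)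
  then show ?thesis using set_lebesgue_integral_eq_integral(2)[OF F] by simp
qed

text \<open>
  Where \<open>\<phi>\<close> vanishes near a point, so does its derivative; hence differentiation does not enlarge the support.
\<close>

lemma deriv_test_function:
  assumes "\<phi> \<in> test_functions \<Omega>"
  shows "deriv \<phi> \<in> test_functions \<Omega>"
proof -
  have "(deriv ^^ n) (deriv \<phi>) field_differentiable at x" for n x
  proof -
    have "(deriv ^^ Suc n) \<phi> field_differentiable at x"
      using assms unfolding test_functions_def by blast
    then show ?thesis by (simp add: funpow_swap1)
  qed
  moreover have sub: "closure {x. deriv \<phi> x \<noteq> 0} \<subseteq> closure {x. \<phi> x \<noteq> 0}"
  proof (rule closure_minimal)
    show "{x. deriv \<phi> x \<noteq> 0} \<subseteq> closure {x. \<phi> x \<noteq> 0}"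
    proof (intro subsetI, rule ccontr)
      fix x assume x: "x \<in> {x. deriv \<phi> x \<noteq> 0}" and nx: "x \<notin> closure {x. \<phi> x \<noteq> 0}"
      have "\<forall>\<^sub>F y in nhds x. y \<in> - closure {x. \<phi> x \<noteq> 0}"
        using nx by (intro eventually_nhds_in_open) auto
      then have "\<forall>\<^sub>F y in nhds x. \<phi> y = 0"
        by (rule eventually_mono) (use closure_subset[of "{x. \<phi> x \<noteq> 0}"] in auto)
      from deriv_cong_ev[OF this refl] have "deriv \<phi> x = 0" by simp
      with x show False by simp
    qed
  qed simp
  moreover have "compact (closure {x. deriv \<phi> x \<noteq> 0})"
    using compact_Int_closed[of "closure {x. \<phi> x \<noteq> 0}" "closure {x. deriv \<phi> x \<noteq> 0}"] assms sub
    by (simp add: test_functions_def Int_absorb1)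
  ultimately show ?thesis
    using assms unfolding test_functions_def by blast
qed

lemma test_function_support:
  assumes "\<phi> \<in> test_functions \<Omega>"
  obtains L where "L > 0" "\<And>x. \<bar>x\<bar> \<ge> L \<Longrightarrow> \<phi> x = 0"
proof -
  have "bounded {x. \<phi> x \<noteq> 0}"
    using assms by (auto simp: test_functions_def intro: bounded_subset[OF compact_imp_bounded closure_subset])
  then obtain B where "B > 0" "\<And>x. \<phi> x \<noteq> 0 \<Longrightarrow> \<bar>x\<bar> \<le> B"
    unfolding bounded_pos by auto
  then show thesis by (intro that[of "B + 1"]) force+
qed

lemma test_function_has_real_derivative:
  assumes "\<phi> \<in> test_functions \<Omega>"
  shows "(\<phi> has_real_derivative deriv \<phi> x) (at x)"
proof -
  have "(deriv ^^ 0) \<phi> field_differentiable at x" using assms unfolding test_functions_def by blast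
  then show ?thesis by (simp add: field_differentiable_derivI)
qed

lemma continuous_test_function:
  assumes "\<phi> \<in> test_functions \<Omega>"
  shows "continuous_on S \<phi>"
  using test_function_has_real_derivative[OF assms]
  by (intro continuous_at_imp_continuous_on) (auto intro: DERIV_isCont)

text \<open>
  Partial integration on an interval that contains the supports of \<open>\<phi>\<close> and of its derivative; the boundary
  terms vanish there.
\<close>

lemma has_weak_deriv_indefinite_integral:
  fixes g q :: "real \<Rightarrow> complex"
  assumes q: "\<And>a b. q absolutely_integrable_on {a..b}"
    and g: "\<And>a b. a \<le> b \<Longrightarrow> g b - g a = integral {a..b} q"
  shows "has_weak_deriv UNIV 1 g q"
  unfolding has_weak_deriv_def
proof (intro conjI ballI)
  have cg: "continuous_on UNIV g"
    using q by (intro continuous_indefinite_integral[OF _ g]) (auto simp: absolutely_integrable_on_def)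
  show "g locally_integrable_on UNIV" "q locally_integrable_on UNIV"
    using q continuous_absolutely_integrable[OF cg] by (auto intro: locally_integrable_on_UNIV_I)
  fix \<phi> assume \<phi>: "\<phi> \<in> test_functions UNIV"
  obtain L1 where L1: "L1 > 0" "\<And>x. \<bar>x\<bar> \<ge> L1 \<Longrightarrow> \<phi> x = 0"
    by (rule test_function_support[OF \<phi>]) (rule that)
  obtain L2 where L2: "L2 > 0" "\<And>x. \<bar>x\<bar> \<ge> L2 \<Longrightarrow> deriv \<phi> x = 0"
    by (rule test_function_support[OF deriv_test_function[OF \<phi>]]) (rule that)
  define L where "L = max L1 L2"
  have L: "L > 0" "\<And>x. \<bar>x\<bar> \<ge> L \<Longrightarrow> \<phi> x = 0" "\<And>x. \<bar>x\<bar> \<ge> L \<Longrightarrow> deriv \<phi> x = 0"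
    using L1 L2 by (auto simp: L_def)
  have d: "((\<lambda>x. complex_of_real (\<phi> x)) has_vector_derivative of_real (deriv \<phi> x)) (at x within S)" for x S
    using test_function_has_real_derivative[OF \<phi>, of x]
    by (intro has_vector_derivative_of_real) (auto intro: DERIV_subset)
  have "(LINT x|lebesgue_on UNIV. g x * of_real ((deriv ^^ 1) \<phi> x)) = integral {- L..L} (\<lambda>x. g x * of_real (deriv \<phi> x))"
    unfolding funpow_simps_right(2) by (simp, intro LINT_eq_integral_Icc absolutely_integrable_continuous_real
      continuous_intros continuous_on_subset[OF cg] continuous_test_function[OF deriv_test_function[OF \<phi>]])
      (auto simp: L(3))
  also have "\<dots> = g L * of_real (\<phi> L) - g (- L) * of_real (\<phi> (- L)) - integral {- L..L} (\<lambda>x. q x * of_real (\<phi> x))"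
    using L(1) by (intro integration_by_parts_indefinite_integral q g d continuous_intros
        continuous_test_function[OF deriv_test_function[OF \<phi>]]) auto
  also have "\<dots> = - integral {- L..L} (\<lambda>x. q x * of_real (\<phi> x))"
    using L(1) by (simp add: L(2))
  also have "integral {- L..L} (\<lambda>x. q x * of_real (\<phi> x)) = (LINT x|lebesgue_on UNIV. q x * of_real (\<phi> x))"
    by (intro LINT_eq_integral_Icc[symmetric] absolutely_integrable_mult_continuous q continuous_intros
          continuous_test_function[OF \<phi>]) (auto simp: L(2))
  finally show "(LINT x|lebesgue_on UNIV. g x * of_real ((deriv ^^ 1) \<phi> x)) =
        (-1) ^ 1 * (LINT x|lebesgue_on UNIV. q x * of_real (\<phi> x))" by simp
qed

lemma has_weak_deriv_trans:
  assumes g: "has_weak_deriv \<Omega> 1 g q" and q: "has_weak_deriv \<Omega> 1 q r"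
  shows "has_weak_deriv \<Omega> 2 g r"
  unfolding has_weak_deriv_def
proof (intro conjI ballI)
  show "g locally_integrable_on \<Omega>" "r locally_integrable_on \<Omega>"
    using assms by (auto simp: has_weak_deriv_def)
  fix \<phi> assume \<phi>: "\<phi> \<in> test_functions \<Omega>"
  have "(LINT x|lebesgue_on \<Omega>. g x * of_real (deriv (deriv \<phi>) x)) = - (LINT x|lebesgue_on \<Omega>. q x * of_real (deriv \<phi> x))"
    using g deriv_test_function[OF \<phi>] by (simp add: has_weak_deriv_def)
  also have "\<dots> = (LINT x|lebesgue_on \<Omega>. r x * of_real (\<phi> x))"
    using q \<phi> by (simp add: has_weak_deriv_def)
  finally show "(LINT x|lebesgue_on \<Omega>. g x * of_real ((deriv ^^ 2) \<phi> x)) =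
        (-1) ^ 2 * (LINT x|lebesgue_on \<Omega>. r x * of_real (\<phi> x))"
    by (simp add: numeral_2_eq_2)
qed

text \<open>
  The argument is shifted into \<open>[0, 2\<pi>)\<close> by the multiple of \<open>2\<pi>\<close> given by the integer part of \<open>x / 2\<pi>\<close>.  The end points, where the value is
  arbitrary, form a null set.
\<close>

lemma periodic_extension:
  assumes f: "f square_integrable_on {0<..<2 * pi}"
  obtains fp where "\<And>x. fp (x + 2 * pi) = fp x" "\<And>x. x \<in> {0<..<2 * pi} \<Longrightarrow> fp x = f x"
    "fp absolutely_integrable_on {0..2 * pi}" "(\<lambda>x. (cmod (fp x))\<^sup>2) integrable_on {0..2 * pi}"
proof -
  define fp where "fp x = f (x - 2 * pi * of_int \<lfloor>x / (2 * pi)\<rfloor>)" for x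
  have per: "fp (x + 2 * pi) = fp x" for x
  proof -
    have "(x + 2 * pi) / (2 * pi) = x / (2 * pi) + 1" by (simp add: add_divide_distrib)
    then have "\<lfloor>(x + 2 * pi) / (2 * pi)\<rfloor> = \<lfloor>x / (2 * pi)\<rfloor> + 1" by simp
    then show ?thesis by (simp add: fp_def algebra_simps)
  qed
  have eq: "fp x = f x" if "x \<in> {0<..<2 * pi}" for x
  proof -
    have "\<lfloor>x / (2 * pi)\<rfloor> = 0" using that by (simp add: floor_eq_iff)
    then show ?thesis by (simp add: fp_def)
  qed
  have meas: "f \<in> borel_measurable (lebesgue_on {0<..<2 * pi})"
    and int2: "integrable (lebesgue_on {0<..<2 * pi}) (\<lambda>x. (cmod (f x))\<^sup>2)"
    using f by (auto simp: square_integrable_on_def)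
  have f2: "(\<lambda>x. (cmod (f x))\<^sup>2) integrable_on {0<..<2 * pi}"
    by (rule integrable_on_lebesgue_on[OF int2]) simp
  have "f absolutely_integrable_on {0<..<2 * pi}"
  proof (rule measurable_bounded_by_integrable_imp_absolutely_integrable[OF meas])
    show "(\<lambda>x. 1 + (cmod (f x))\<^sup>2) integrable_on {0<..<2 * pi}"
      by (intro Henstock_Kurzweil_Integration.integrable_add f2)
         (simp add: integrable_on_const)
    fix x
    have "2 * cmod (f x) \<le> 1 + (cmod (f x))\<^sup>2" using sum_squares_bound[of 1 "cmod (f x)"] by simp
    with norm_ge_zero[of "f x"] show "norm (f x) \<le> 1 + (cmod (f x))\<^sup>2" by linarith
  qed simp
  then have "f absolutely_integrable_on {0..2 * pi}"
    using absolutely_integrable_on_open_interval[where f = f and a = 0 and b = "2 * pi"] by (simp add: box_real)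
  then have ai: "fp absolutely_integrable_on {0..2 * pi}"
    by (rule absolutely_integrable_spike[of _ _ "{0, 2 * pi}"]) (auto intro!: eq)
  have "(\<lambda>x. (cmod (f x))\<^sup>2) integrable_on {0..2 * pi}"
    using f2 integrable_on_open_interval[where a = 0 and b = "2 * pi" and f = "\<lambda>x. (cmod (f x))\<^sup>2"] by (simp add: box_real)
  then have i2: "(\<lambda>x. (cmod (fp x))\<^sup>2) integrable_on {0..2 * pi}"
    by (rule integrable_spike[of _ _ "{0, 2 * pi}"]) (auto simp: eq)
  show thesis by (rule that[OF per eq ai i2])
qed

section \<open>Existence of a periodic solution\<close>

theorem theorem1:
  fixes d \<zeta> \<omega> :: real and f :: "real \<Rightarrow> complex"
  assumes "d \<noteq> 0"
    and "f \<in> sobolev_H 2 {0<..<2 * pi}"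
  shows "\<exists>u \<in> sobolev_H_per 2 (2 * pi). \<exists>u' u''.
           has_weak_deriv UNIV 1 u u' \<and> has_weak_deriv UNIV 2 u u'' \<and>
           (AE s in lebesgue_on {0<..<2 * pi}.
              - of_real d * u'' s + \<i> * of_real \<omega> * u' s + (of_real \<zeta> - \<i>) * u s
              - of_real ((cmod (u s))\<^sup>2) * u s + \<i> * f s = 0)"
proof -
  have "f square_integrable_on {0<..<2 * pi}" using assms(2) by (simp add: sobolev_H_def)
  then obtain F where perF: "\<And>x. F (x + 2 * pi) = F x" and Ff: "\<And>x. x \<in> {0<..<2 * pi} \<Longrightarrow> F x = f x"
    and F: "F absolutely_integrable_on {0..2 * pi}" and F2: "(\<lambda>x. (cmod (F x))\<^sup>2) integrable_on {0..2 * pi}"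
    using periodic_extension by blast
  obtain u where cu: "continuous_on UNIV u" and peru: "\<And>x. u (x + 2 * pi) = u x"
    and coeffs: "\<And>k. (of_real (d * (real_of_int k)\<^sup>2 - \<omega> * of_int k + \<zeta>) - \<i>) * fourier_coeff u k =
             fourier_coeff (\<lambda>x. cubic (u x)) k - \<i> * fourier_coeff F k"
    by (rule fourier_solution_exists[OF assms(1) F F2, where \<omega> = \<omega> and \<zeta> = \<zeta>]) (rule that)
  \<comment> \<open>The forcing is kept apart from the continuous part \<open>g\<close> of the right-hand side \<open>h\<close>.\<close>
  define g where "g x = cubic (u x) - (of_real \<zeta> - \<i>) * u x" for x
  define h where "h x = g x - \<i> * F x" for x
  have cg: "continuous_on UNIV g" unfolding g_def by (intro continuous_intros cu)
  have iF: "(\<lambda>x. \<i> * F x) absolutely_integrable_on {0..2 * pi}" by (rule absolutely_integrable_cmul[OF F])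
  have hai: "h absolutely_integrable_on {0..2 * pi}"
    unfolding h_def by (intro set_integral_diff(1) continuous_absolutely_integrable cg iF)
  have perh: "h (x + 2 * pi) = h x" for x by (simp add: h_def g_def peru perF)
  have "of_real (d * (real_of_int k)\<^sup>2 - \<omega> * of_int k) * fourier_coeff u k = fourier_coeff h k" for k
  proof -
    have "fourier_coeff h k = fourier_coeff g k - \<i> * fourier_coeff F k"
      unfolding h_def fourier_coeff_mult[symmetric]
      by (intro fourier_coeff_diff continuous_absolutely_integrable cg iF)
    also have "fourier_coeff g k = fourier_coeff (\<lambda>x. cubic (u x)) k - (of_real \<zeta> - \<i>) * fourier_coeff u k"
      unfolding g_def fourier_coeff_mult[symmetric]
      by (intro fourier_coeff_diff continuous_absolutely_integrable continuous_intros cu)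
    finally have hk: "fourier_coeff h k
        = fourier_coeff (\<lambda>x. cubic (u x)) k - (of_real \<zeta> - \<i>) * fourier_coeff u k - \<i> * fourier_coeff F k" .
    have "of_real (d * (real_of_int k)\<^sup>2 - \<omega> * of_int k) * fourier_coeff u k
        = (of_real (d * (real_of_int k)\<^sup>2 - \<omega> * of_int k + \<zeta>) - \<i>) * fourier_coeff u k
          - (of_real \<zeta> - \<i>) * fourier_coeff u k"
      by (simp add: algebra_simps)
    then show ?thesis unfolding coeffs hk by simp
  qed
  then obtain p where cp: "continuous_on UNIV p"
    and ud: "\<And>a b. a \<le> b \<Longrightarrow> u b - u a = integral {a..b} p"
    and pd: "\<And>a b. a \<le> b \<Longrightarrow> p b - p a = integral {a..b} (\<lambda>x. (\<i> * of_real \<omega> * p x - h x) / of_real d)"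
    by (rule regularity_from_fourier_coeffs[OF assms(1) cu peru hai perh]) (rule that)
  define v where "v x = (\<i> * of_real \<omega> * p x - h x) / of_real d" for x
  define q where "q x = (\<i> * of_real \<omega> * p x - g x) / of_real d" for x
  have v_eq: "v x = q x + \<i> / of_real d * F x" for x
    by (simp add: v_def q_def h_def diff_divide_distrib)
  have cq: "continuous_on UNIV q" unfolding q_def using assms(1) by (intro continuous_intros cp cg) auto
  have Fai: "F absolutely_integrable_on {a..b}" for a b
    by (rule periodic_absolutely_integrable_on[OF perF _ F]) simp
  have F2i: "(\<lambda>x. (cmod (F x))\<^sup>2) integrable_on {a..b}" for a b
    by (rule periodic_integrable_on[OF _ _ F2]) (simp_all add: perF)
  have vai: "v absolutely_integrable_on {a..b}" for a b
    unfolding v_eq by (intro set_integral_add(1) continuous_absolutely_integrable cq absolutely_integrable_cmul Fai)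
  have v2i: "(\<lambda>x. (cmod (v x))\<^sup>2) integrable_on {a..b}" for a b
  proof (rule measurable_bounded_by_integrable_imp_integrable)
    have "v \<in> borel_measurable (lebesgue_on {a..b})"
      by (rule absolutely_integrable_imp_borel_measurable[OF vai]) simp
    then show "(\<lambda>x. (cmod (v x))\<^sup>2) \<in> borel_measurable (lebesgue_on {a..b})" by measurable
    show "(\<lambda>x. 2 * (cmod (q x))\<^sup>2 + 2 * (cmod (\<i> / of_real d))\<^sup>2 * (cmod (F x))\<^sup>2) integrable_on {a..b}"
      by (intro Henstock_Kurzweil_Integration.integrable_add integrable_on_mult_right F2i
            integrable_continuous_interval continuous_intros continuous_on_subset[OF cq]) auto
    fix x
    have "(cmod (v x))\<^sup>2 \<le> (cmod (q x) + cmod (\<i> / of_real d) * cmod (F x))\<^sup>2"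
      unfolding v_eq norm_mult[symmetric] by (intro power_mono norm_triangle_ineq) auto
    also have "\<dots> \<le> 2 * (cmod (q x))\<^sup>2 + 2 * (cmod (\<i> / of_real d) * cmod (F x))\<^sup>2"
      using sum_squares_bound[of "cmod (q x)" "cmod (\<i> / of_real d) * cmod (F x)"] unfolding power2_sum by linarith
    finally show "norm ((cmod (v x))\<^sup>2) \<le> 2 * (cmod (q x))\<^sup>2 + 2 * (cmod (\<i> / of_real d))\<^sup>2 * (cmod (F x))\<^sup>2"
      by (simp add: power_mult_distrib)
  qed simp
  have sq: "g locally_square_integrable_on UNIV" if "continuous_on UNIV g" for g
    by (intro locally_square_integrable_on_UNIV_I continuous_absolutely_integrable that
         integrable_continuous_interval continuous_intros continuous_on_subset[OF that]) auto
  have w1: "has_weak_deriv UNIV 1 u p"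
    by (intro has_weak_deriv_indefinite_integral continuous_absolutely_integrable cp ud)
  have w2: "has_weak_deriv UNIV 2 u v"
    using w1 has_weak_deriv_indefinite_integral[OF vai pd[folded v_def]] by (rule has_weak_deriv_trans)
  have "\<exists>w. has_weak_deriv UNIV k u w \<and> w locally_square_integrable_on UNIV" if "k \<in> {1..2}" for k
  proof -
    have "k = 1 \<or> k = 2" using that by auto
    then show ?thesis
      using w1 w2 sq[OF cp] locally_square_integrable_on_UNIV_I[OF vai v2i] by auto
  qed
  then have mem: "u \<in> sobolev_H_per 2 (2 * pi)"
    using peru sq[OF cu] by (simp add: sobolev_H_per_def)
  have "- of_real d * v s + \<i> * of_real \<omega> * p s + (of_real \<zeta> - \<i>) * u s
        - of_real ((cmod (u s))\<^sup>2) * u s + \<i> * f s = 0" if "s \<in> {0<..<2 * pi}" for s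
    using assms(1) Ff[OF that] by (simp add: v_def h_def g_def cubic_def)
  then have "AE s in lebesgue_on {0<..<2 * pi}.
              - of_real d * v s + \<i> * of_real \<omega> * p s + (of_real \<zeta> - \<i>) * u s
              - of_real ((cmod (u s))\<^sup>2) * u s + \<i> * f s = 0"
    by (intro AE_I2) simp
  with mem w1 w2 show ?thesis by blast
qed

end
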